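(* Let $T>0$ and $L\ge 0$ be constants, and let $l_1,l_2:[0,T]\to\mathbb{R}$ be continuously differentiable functions with $l_1(0)=0$, $l_2(0)=L$ and $l_1(s)<l_2(s)$ for all $s>0$. Let $q_0\in \mathbf{C}^1[0,L]$ and $f_0,g_0\in \mathbf{C}^1[0,T]$. Let $q(x,t)$ be the solution of the heat equation $q_t-q_{xx}=0$ in the domain $\{(x,t): l_1(t)<x<l_2(t),\ 0<t<T\}$ satisfying the initial and Dirichlet boundary conditions $$q(x,0)=q_0(x),\ 0<x<L;\qquad q(l_1(t),t)=f_0(t),\quad q(l_2(t),t)=g_0(t),\ 0<t<T.$$ Denote the Neumann boundary values by $$f_1(t)=q_x(l_1(t),t),\qquad g_1(t)=q_x(l_2(t),t),\qquad 0<t<T.$$ Then $f_1$ and $g_1$ can be expressed in terms of the given initial and boundary data as the solution of the following system of coupled linear integral equations, i.e. they satisfy $$\pi f_1(t)=N_1(t)+\int_{0}^{t}K_{11}(t,s)f_1(s)\,ds-\int_0^tK_{12}(t,s)g_1(s)\,ds,\qquad 0<t<T,$$ $$\pi g_1(t)=N_2(t)-\int_{0}^{t}K_{22}(t,s)g_1(s)\,ds+\int_0^tK_{21}(t,s)f_1(s)\,ds,\qquad 0<t<T,$$ where, for $j=1,2$, $$N_j(t)=\sqrt{\pi}\left\{\frac{1}{\sqrt{t}}\int_{0}^{L}e^{-\frac{(x-l_j(t))^2}{4t}}q'_0(x)\,dx-\int_{0}^{t}\left[\frac{e^{-\frac{(l_j(t)-l_1(s))^2}{4(t-s)}}}{\sqrt{t-s}}f_0'(s)-\frac{e^{-\frac{(l_j(t)-l_2(s))^2}{4(t-s)}}}{\sqrt{t-s}}g_0'(s)\right]ds\right\}$$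 and, for $j,m\in\{1,2\}$, $$K_{jm}(t,s)=\frac{\sqrt{\pi}}{2}\,\frac{l_j(t)-l_m(s)}{t-s}\,\frac{e^{-\frac{(l_j(t)-l_m(s))^2}{4(t-s)}}}{\sqrt{t-s}},\qquad 0<s<t<T.$$
   Context: A prime denotes the ordinary derivative. The solution $q$ is understood to be sufficiently regular up to the boundary of the domain for the Neumann boundary values to be well defined, with $f_1,g_1\in \mathbf{C}[0,T]$. *)

theory Defs
  imports "HOL-Analysis.Analysis"
begin

(* One-sided derivatives at the end points of a closed interval S.  If S is a single point
   (the case L = 0 for the initial datum), every f' qualifies. *)
definition C1_on :: "(real \<Rightarrow> real) \<Rightarrow> (real \<Rightarrow> real) \<Rightarrow> real set \<Rightarrow> bool" where
  "C1_on f f' S \<longleftrightarrow>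
     (\<forall>x\<in>S. (f has_real_derivative f' x) (at x within S)) \<and> continuous_on S f'"

definition moving_domain :: "(real \<Rightarrow> real) \<Rightarrow> (real \<Rightarrow> real) \<Rightarrow> real \<Rightarrow> (real \<times> real) set" where
  "moving_domain l1 l2 T = {(x, t). 0 < t \<and> t < T \<and> l1 t < x \<and> x < l2 t}"

(* Classical solutions: q_t, q_x and q_xx exist and are continuous in the open set D. *)
definition heat_solution_on :: "(real \<times> real) set \<Rightarrow> (real \<Rightarrow> real \<Rightarrow> real) \<Rightarrow> bool" where
  "heat_solution_on D q \<longleftrightarrow>
     (\<exists>qt qx qxx.
        (\<forall>(x, t)\<in>D.
           ((\<lambda>s. q x s) has_real_derivative qt x t) (at t) \<and>
           ((\<lambda>y. q y t) has_real_derivative qx x t) (at x) \<and>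
           ((\<lambda>y. qx y t) has_real_derivative qxx x t) (at x) \<and>
           qt x t - qxx x t = 0) \<and>
        continuous_on D (\<lambda>(x, t). qt x t) \<and>
        continuous_on D (\<lambda>(x, t). qx x t) \<and>
        continuous_on D (\<lambda>(x, t). qxx x t))"

(* q is continuous up to the lateral boundary and the initial line; its x-derivative qx
   (one-sided on the lateral boundary) is continuous up to the lateral boundary.  Nothing is
   required of qx as t tends to 0, nor of q or qx as t tends to T. *)
definition regular_up_to_boundary ::
  "(real \<Rightarrow> real) \<Rightarrow> (real \<Rightarrow> real) \<Rightarrow> real \<Rightarrow> (real \<Rightarrow> real \<Rightarrow> real) \<Rightarrow> (real \<Rightarrow> real \<Rightarrow> real) \<Rightarrow> bool"
where
  "regular_up_to_boundary l1 l2 T q qx \<longleftrightarrow>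
     continuous_on {(x, t). 0 \<le> t \<and> t < T \<and> l1 t \<le> x \<and> x \<le> l2 t} (\<lambda>(x, t). q x t) \<and>
     (\<forall>t x. 0 < t \<and> t < T \<and> l1 t \<le> x \<and> x \<le> l2 t \<longrightarrow>
        ((\<lambda>y. q y t) has_real_derivative qx x t) (at x within {l1 t..l2 t})) \<and>
     continuous_on {(x, t). 0 < t \<and> t < T \<and> l1 t \<le> x \<and> x \<le> l2 t} (\<lambda>(x, t). qx x t)"

(* The factor exp (- (lj t - lm s)^2 / (4 (t - s))) / sqrt (t - s); its value at s = t
   (0, by division by zero) is irrelevant under the integrals over {0..t}. *)
definition heat_kernel ::
  "(real \<Rightarrow> real) \<Rightarrow> (real \<Rightarrow> real) \<Rightarrow> real \<Rightarrow> real \<Rightarrow> real"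
where
  "heat_kernel lj lm t s = exp (- ((lj t - lm s)\<^sup>2 / (4 * (t - s)))) / sqrt (t - s)"

(* K_jm is kernel_K lj lm, and N_j is data_N L lj l1 l2 q0' f0' g0'. *)
definition kernel_K ::
  "(real \<Rightarrow> real) \<Rightarrow> (real \<Rightarrow> real) \<Rightarrow> real \<Rightarrow> real \<Rightarrow> real"
where
  "kernel_K lj lm t s = sqrt pi / 2 * ((lj t - lm s) / (t - s)) * heat_kernel lj lm t s"

definition data_N ::
  "real \<Rightarrow> (real \<Rightarrow> real) \<Rightarrow> (real \<Rightarrow> real) \<Rightarrow> (real \<Rightarrow> real) \<Rightarrow>
   (real \<Rightarrow> real) \<Rightarrow> (real \<Rightarrow> real) \<Rightarrow> (real \<Rightarrow> real) \<Rightarrow> real \<Rightarrow> real"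
where
  "data_N L lj l1 l2 q0' f0' g0' t =
     sqrt pi *
       (1 / sqrt t * integral {0..L} (\<lambda>x. exp (- ((x - lj t)\<^sup>2 / (4 * t))) * q0' x)
        - integral {0..t} (\<lambda>s. heat_kernel lj l1 t s * f0' s - heat_kernel lj l2 t s * g0' s))"

end

theory Submission
  imports Defs "HOL-Probability.Distributions"
begin

text \<open>
  For a pole \<open>(\<xi>, t)\<close> let \<open>v(y, s) = exp (-(\<xi> - y)\<^sup>2 / (4 (t - s))) / sqrt (t - s)\<close>, a solution of the
  backward heat equation.  Put \<open>\<Phi>(s) = \<integral> v q\<^sub>y dy\<close> over \<open>l\<^sub>1(s) \<le> y \<le> l\<^sub>2(s)\<close>.  Green's identity
  for \<open>q\<close> and \<open>v\<^sub>y\<close>, followed by an integration by parts along each boundary curve, gives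
  \<open>\<Phi>(0) - \<Phi>(s) = \<integral>\<^sub>0\<^sup>s [v\<^sub>y g\<^sub>1 - v g\<^sub>0'](l\<^sub>2) - [v\<^sub>y f\<^sub>1 - v f\<^sub>0'](l\<^sub>1)\<close>.  The pole is placed directly on
  the boundary, \<open>\<xi> = l\<^sub>j(t)\<close>, so that no jump relation for the double layer potential is needed:
  as \<open>s\<close> tends to \<open>t\<close> the moving interval, rescaled by \<open>2 sqrt (t - s)\<close> about \<open>\<xi>\<close>, exhausts a
  half line, because \<open>l\<^sub>j(s) - l\<^sub>j(t) = O(t - s)\<close>, and \<open>\<Phi>(s)\<close> tends to \<open>sqrt \<pi> q\<^sub>x(\<xi>, t)\<close>.
\<close>

section \<open>Calculus tools: a conservation law, a chain rule and weakly singular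
  integrands\<close>

text \<open>Both sides are the double integral of \<open>R\<close>, evaluated once by integrating in
  s first and once in x first. \<open>P\<close> and \<open>Q\<close> are the density and the current
  of a conservation law in coordinates that fix the moving domain.\<close>

lemma conservation_law_rectangle:
  fixes P Q R :: "real \<Rightarrow> real \<Rightarrow> real"
  assumes "c \<le> d"
    and contP: "continuous_on ({0..1} \<times> {c..d}) (\<lambda>(x, s). P x s)"
    and contQ: "continuous_on ({0..1} \<times> {c..d}) (\<lambda>(x, s). Q x s)"
    and contR: "continuous_on ({0<..<1} \<times> {c..d}) (\<lambda>(x, s). R x s)"
    and derP: "\<And>x s. 0 < x \<Longrightarrow> x < 1 \<Longrightarrow> c \<le> s \<Longrightarrow> s \<le> d \<Longrightarrow>
                 ((\<lambda>s. P x s) has_real_derivative R x s) (at s)"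
    and derQ: "\<And>x s. 0 < x \<Longrightarrow> x < 1 \<Longrightarrow> c \<le> s \<Longrightarrow> s \<le> d \<Longrightarrow>
                 ((\<lambda>x. Q x s) has_real_derivative R x s) (at x)"
  shows "integral {0..1} (\<lambda>x. P x d) - integral {0..1} (\<lambda>x. P x c)
       = integral {c..d} (\<lambda>s. Q 1 s - Q 0 s)"
proof -
  text \<open>\<open>R\<close> need not extend continuously to \<open>x = 0\<close> and \<open>x = 1\<close>, so the identity is shown on
    \<open>{e..1-e}\<close> first.\<close>
  have inner: "integral {e..1-e} (\<lambda>x. P x d - P x c) = integral {c..d} (\<lambda>s. Q (1-e) s - Q e s)"
    if e: "0 < e" "e < 1/2" for e
  proof -
    have "integral {e..1-e} (\<lambda>x. P x d - P x c) = integral {e..1-e} (\<lambda>x. integral {c..d} (R x))"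
    proof (rule integral_cong)
      fix x assume x: "x \<in> {e..1-e}"
      have "((\<lambda>s. R x s) has_integral P x d - P x c) {c..d}"
        using x e \<open>c \<le> d\<close>
        by (intro fundamental_theorem_of_calculus[OF _ has_vector_derivative_at_within])
           (auto simp: has_real_derivative_iff_has_vector_derivative[symmetric] intro!: derP)
      then show "P x d - P x c = integral {c..d} (R x)"
        by (simp add: integral_unique)
    qed
    also have "\<dots> = integral {c..d} (\<lambda>s. integral {e..1-e} (\<lambda>x. R x s))"
    proof -
      have "continuous_on (cbox (e, c) (1-e, d)) (\<lambda>(x, s). R x s)"
        using e by (intro continuous_on_subset[OF contR]) (auto simp: cbox_Pair_eq)
      from integral_swap_continuous[OF this] show ?thesis
        by simp
    qed
    also have "\<dots> = integral {c..d} (\<lambda>s. Q (1-e) s - Q e s)"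
    proof (rule integral_cong)
      fix s assume s: "s \<in> {c..d}"
      have "((\<lambda>x. R x s) has_integral Q (1-e) s - Q e s) {e..1-e}"
        using s e
        by (intro fundamental_theorem_of_calculus[OF _ has_vector_derivative_at_within])
           (auto simp: has_real_derivative_iff_has_vector_derivative[symmetric] intro!: derQ)
      then show "integral {e..1-e} (\<lambda>x. R x s) = Q (1-e) s - Q e s"
        by (rule integral_unique)
    qed
    finally show ?thesis .
  qed
  let ?S = "{0<..<1/2::real}"
  have closure: "closure ?S = {0..1/2}" by simp
  have contPc: "continuous_on {0..1} (\<lambda>x. P x s)" if "s \<in> {c..d}" for s
    using that by (intro continuous_on_compose2[OF contP, where f = "\<lambda>x. (x, s)", simplified])
      (auto intro!: continuous_intros)
  let ?p = "\<lambda>x. P x d - P x c"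
  have contp: "continuous_on {0..1} ?p"
    using \<open>c \<le> d\<close> by (intro continuous_on_diff contPc) auto
  \<comment> \<open>The defect of the identity on \<open>{e..1-e}\<close>. It is zero for 0 < e <
    1/2 and continuous on [0, 1/2], hence zero at e = 0.\<close>
  define F where "F = (\<lambda>e. integral {e..1-e} ?p - integral {c..d} (\<lambda>s. Q (1-e) s - Q e s))"
  have "F 0 = 0"
  proof (rule continuous_constant_on_closure[of ?S F])
    have intp: "?p integrable_on {0..1}"
      using contp by (rule integrable_continuous_real)
    have "continuous_on {0..1/2} (\<lambda>e. integral {0..1-e} ?p - integral {0..e} ?p)"
      by (intro continuous_on_diff continuous_on_compose2[OF indefinite_integral_continuous_1[OF intp]]
          continuous_intros) auto
    moreover have "integral {0..1-e} ?p - integral {0..e} ?p = integral {e..1-e} ?p"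
      if "e \<in> {0..1/2}" for e
    proof -
      have "?p integrable_on {0..1-e}"
        by (rule integrable_subinterval_real[OF intp]) (use that in auto)
      from Henstock_Kurzweil_Integration.integral_combine[OF _ _ this, of e] that show ?thesis by auto
    qed
    ultimately have 1: "continuous_on {0..1/2} (\<lambda>e. integral {e..1-e} ?p)"
      by (rule continuous_on_eq) auto
    have "continuous_on ({0..1/2} \<times> cbox c d) (\<lambda>(e, s). Q (1-e) s - Q e s)"
      unfolding split_beta
      by (intro continuous_on_diff continuous_on_compose2[OF contQ[unfolded split_beta], where f = "\<lambda>p. (1 - fst p, snd p)", simplified]
            continuous_on_subset[OF contQ[unfolded split_beta]])
         (auto intro!: continuous_intros)
    from integral_continuous_on_param[OF this]
    have 2: "continuous_on {0..1/2} (\<lambda>e. integral {c..d} (\<lambda>s. Q (1-e) s - Q e s))"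
      by simp
    show "continuous_on (closure ?S) F"
      unfolding closure F_def by (intro continuous_on_diff 1 2)
  qed (use inner in \<open>auto simp: F_def\<close>)
  moreover have "integral {0..1} ?p = integral {0..1} (\<lambda>x. P x d) - integral {0..1} (\<lambda>x. P x c)"
    using \<open>c \<le> d\<close> by (intro integral_diff integrable_continuous_real contPc) auto
  ultimately show ?thesis by (simp add: F_def)
qed

text \<open>Continuity of \<open>qt\<close>, together with the partial derivative in x, gives joint
  differentiability of q at the point; the derivative along the curve is then the chain
  rule.\<close>

lemma DERIV_along_curve:
  fixes q qt qx :: "real \<Rightarrow> real \<Rightarrow> real" and y :: "real \<Rightarrow> real"
  assumes "open D" "(y s, s) \<in> D"
    and dt: "\<And>x t. (x, t) \<in> D \<Longrightarrow> ((\<lambda>s. q x s) has_real_derivative qt x t) (at t)"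
    and dx: "\<And>x t. (x, t) \<in> D \<Longrightarrow> ((\<lambda>x. q x t) has_real_derivative qx x t) (at x)"
    and cont: "continuous_on D (\<lambda>(x, t). qt x t)"
    and y: "(y has_real_derivative y') (at s)"
  shows "((\<lambda>s. q (y s) s) has_real_derivative qt (y s) s + qx (y s) s * y') (at s)"
proof -
  obtain A B where AB: "open A" "open B" "(y s, s) \<in> A \<times> B" "A \<times> B \<subseteq> D"
    using open_prod_elim[OF assms(1,2)] by blast
  then obtain e where e: "e > 0" "ball s e \<subseteq> B"
    by (auto simp: open_contains_ball)
  \<comment> \<open>The second factor is shrunk to a ball because the criterion for joint
    differentiability asks for a convex set there.\<close>
  define Y where "Y = ball s e"
  have sub: "A \<times> Y \<subseteq> D" using e AB by (auto simp: Y_def)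
  have Y: "s \<in> Y" "convex Y" "open Y" using e by (auto simp: Y_def)
  have opn: "open (A \<times> Y)" using AB Y by (intro open_Times)
  have mem: "(y s, s) \<in> A \<times> Y" using AB Y by auto
  have "((\<lambda>(x, s). q x s) has_derivative
          (\<lambda>(tx, ty). tx * qx (y s) s + blinfun_scaleR_left (qt (y s) s) ty)) (at (y s, s) within A \<times> Y)"
  proof (rule has_derivative_partialsI[where fx = "\<lambda>h. h * qx (y s) s" and f = q and X = A and Y = Y
        and fy = "\<lambda>x t. blinfun_scaleR_left (qt x t)"])
    show "((\<lambda>x. q x s) has_derivative (\<lambda>h. h * qx (y s) s)) (at (y s) within A)"
      using dx[OF assms(2)] unfolding has_field_derivative_def
      by (auto intro: has_derivative_at_withinI simp: mult_commute_abs)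
    show "((\<lambda>t. q x t) has_derivative blinfun_scaleR_left (qt x t)) (at t within Y)"
      if "x \<in> A" "t \<in> Y" for x t
    proof -
      have "(x, t) \<in> D" using that sub by auto
      from dt[OF this] show ?thesis
        unfolding has_field_derivative_def
        by (auto intro: has_derivative_at_withinI simp: mult_commute_abs)
    qed
    have "continuous_on (A \<times> Y) (\<lambda>(x, t). blinfun_scaleR_left (qt x t))"
      using continuous_on_subset[OF cont sub] unfolding split_beta
      by (intro bounded_linear.continuous_on[OF bounded_linear_blinfun_scaleR_left])
    then show "continuous (at (y s, s) within A \<times> Y) (\<lambda>(x, t). blinfun_scaleR_left (qt x t))"
      using mem by (simp add: continuous_on_eq_continuous_within)
  qed (use Y in auto)
  then have q: "((\<lambda>(x, s). q x s) has_derivative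
          (\<lambda>(tx, ty). tx * qx (y s) s + blinfun_scaleR_left (qt (y s) s) ty)) (at (y s, s))"
    by (simp add: at_within_open[OF mem opn])
  have "((\<lambda>s. (y s, s)) has_derivative (\<lambda>h. (y' * h, h))) (at s)"
    using y unfolding has_field_derivative_def by (intro has_derivative_Pair has_derivative_ident)
  from has_derivative_compose[OF this q]
  have "((\<lambda>s. q (y s) s) has_derivative (\<lambda>h. y' * h * qx (y s) s + h * qt (y s) s)) (at s)"
    by simp
  moreover have "(\<lambda>h. y' * h * qx (y s) s + h * qt (y s) s) = (*) (qt (y s) s + qx (y s) s * y')"
    by (auto simp: fun_eq_iff algebra_simps)
  ultimately show ?thesis
    unfolding has_field_derivative_def by (simp only:)
qed

lemma integrable_inverse_sqrt:
  fixes t :: real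
  assumes "0 \<le> t"
  shows "(\<lambda>s. C / sqrt (t - s)) integrable_on {0..t}"
proof -
  \<comment> \<open>The antiderivative is continuous up to s = t but is differentiated only for s <
    t.\<close>
  have "((\<lambda>s. C / sqrt (t - s)) has_integral (- 2 * C * sqrt (t - t)) - (- 2 * C * sqrt (t - 0))) {0..t}"
  proof (rule fundamental_theorem_of_calculus_interior[OF assms])
    fix s assume s: "s \<in> {0<..<t}"
    show "((\<lambda>s. - 2 * C * sqrt (t - s)) has_vector_derivative C / sqrt (t - s)) (at s)"
      unfolding has_real_derivative_iff_has_vector_derivative[symmetric]
      using s by (auto intro!: derivative_eq_intros simp: field_simps)
  qed (auto intro!: continuous_intros)
  then show ?thesis by blast
qed

text \<open>Continuity on [0, t) gives measurability, the majorant is integrable, and s = t is a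
  null set. Both \<open>kern\<close> and \<open>kern1\<close> along a boundary curve are integrated
  through this criterion.\<close>

lemma absolutely_integrable_inverse_sqrt_bound:
  fixes f :: "real \<Rightarrow> real"
  assumes "0 \<le> t" and cont: "continuous_on {0..<t} f"
    and bound: "\<And>s. 0 \<le> s \<Longrightarrow> s < t \<Longrightarrow> \<bar>f s\<bar> \<le> C / sqrt (t - s)"
  shows "f absolutely_integrable_on {0..t}"
proof -
  have neg: "negligible {x \<in> {0..<t} - {0..t}. g x \<noteq> 0}" "negligible {x \<in> {0..t} - {0..<t}. g x \<noteq> 0}"
    for g :: "real \<Rightarrow> real"
    by (rule negligible_subset[of "{t}"]; force)+
  have "f absolutely_integrable_on {0..<t}"
  proof (rule measurable_bounded_by_integrable_imp_absolutely_integrable)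
    show "f \<in> borel_measurable (lebesgue_on {0..<t})"
      using cont by (rule continuous_imp_measurable_on_sets_lebesgue) auto
    show "(\<lambda>s. C / sqrt (t - s)) integrable_on {0..<t}"
      using integrable_spike_set[OF integrable_inverse_sqrt[OF assms(1)] neg(2) neg(1)] .
  qed (use bound in auto)
  from absolutely_integrable_spike_set[OF this neg] show ?thesis .
qed

subsection \<open>The heat kernel\<close>

text \<open>This is 2 sqrt(pi) times the fundamental solution of the heat equation, at distance d
  from the pole and at time r before it.\<close>

definition kern :: "real \<Rightarrow> real \<Rightarrow> real" where
  "kern d r = exp (- (d\<^sup>2 / (4 * r))) / sqrt r"

text \<open>\<open>kern1\<close>, \<open>kern2\<close>, \<open>kern3\<close> are the first three derivatives of \<open>kern (\<xi> - y) r\<close> in \<open>y\<close>; this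
  explains the minus signs in their derivatives with respect to \<open>d = \<xi> - y\<close>.\<close>

definition kern1 :: "real \<Rightarrow> real \<Rightarrow> real" where
  "kern1 d r = d / (2 * r) * kern d r"

definition kern2 :: "real \<Rightarrow> real \<Rightarrow> real" where
  "kern2 d r = (d\<^sup>2 / (4 * r\<^sup>2) - 1 / (2 * r)) * kern d r"

definition kern3 :: "real \<Rightarrow> real \<Rightarrow> real" where
  "kern3 d r = (d ^ 3 / (8 * r ^ 3) - 3 * d / (4 * r\<^sup>2)) * kern d r"

text \<open>The coefficient of r' is again \<open>kern2\<close>, the second space derivative: this
  is the heat equation for the kernel. Letting d and r both depend on s covers motion along a
  boundary curve as well as along a line of constant time.\<close>

lemma DERIV_kern:
  assumes d: "(d has_real_derivative d') (at s within S)"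
    and r: "(r has_real_derivative r') (at s within S)" and "r s > 0"
  shows "((\<lambda>s. kern (d s) (r s)) has_real_derivative
           - kern1 (d s) (r s) * d' + kern2 (d s) (r s) * r') (at s within S)"
proof -
  have "((\<lambda>s. (d s)\<^sup>2 / (4 * r s)) has_real_derivative
      ((2 * d s * d') * (4 * r s) - (d s)\<^sup>2 * (4 * r')) / (4 * r s)\<^sup>2) (at s within S)"
    using assms(3) by (auto intro!: derivative_eq_intros d r simp: power2_eq_square)
  note 1 = DERIV_chain2[OF DERIV_exp DERIV_minus[OF this]]
  \<comment> \<open>Stated for variables, so that the rearrangements below match syntactically
    without unfolding exponentials and roots.\<close>
  have alg: "E * - X * S + - (I * (r2 * S)) * E = (- X - I * r2) * (E * S)" for E X S I r2 :: real
    by (simp add: algebra_simps)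
  have alg2: "(- (a * d') + b * r') * K = - (a * K) * d' + (b * K) * r'" for a b K :: real
    by (simp add: algebra_simps)
  have sq: "inverse (sqrt (r s)) * inverse (sqrt (r s)) = inverse (r s)"
    using assms(3) by (simp flip: inverse_mult_distrib)
  have "((\<lambda>s. inverse (sqrt (r s))) has_real_derivative
      - (inverse (sqrt (r s)) * (inverse (sqrt (r s)) / 2 * r') * inverse (sqrt (r s)))) (at s within S)"
    using assms(3) by (intro DERIV_inverse' DERIV_chain2[OF DERIV_real_sqrt r]) auto
  moreover have "inverse (sqrt (r s)) * (inverse (sqrt (r s)) / 2 * r') * inverse (sqrt (r s))
      = (inverse (sqrt (r s)) * inverse (sqrt (r s))) * (r' / 2 * inverse (sqrt (r s)))"
    by (simp only: divide_inverse mult_ac)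
  ultimately have 2: "((\<lambda>s. inverse (sqrt (r s))) has_real_derivative
      - (inverse (r s) * (r' / 2 * inverse (sqrt (r s))))) (at s within S)"
    by (simp only: sq)
  have "((\<lambda>s. kern (d s) (r s)) has_real_derivative
      (- (((2 * d s * d') * (4 * r s) - (d s)\<^sup>2 * (4 * r')) / (4 * r s)\<^sup>2) - inverse (r s) * (r' / 2))
        * kern (d s) (r s)) (at s within S)"
    unfolding kern_def divide_inverse[of _ "sqrt _"]
    by (rule DERIV_cong[OF DERIV_mult[OF 1 2] alg])
  moreover have "(- (((2 * d s * d') * (4 * r s) - (d s)\<^sup>2 * (4 * r')) / (4 * r s)\<^sup>2) - inverse (r s) * (r' / 2))
        * kern (d s) (r s) = - kern1 (d s) (r s) * d' + kern2 (d s) (r s) * r'"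
  proof -
    have "(- (((2 * d s * d') * (4 * r s) - (d s)\<^sup>2 * (4 * r')) / (4 * r s)\<^sup>2) - inverse (r s) * (r' / 2))
      = - (d s / (2 * r s) * d') + ((d s)\<^sup>2 / (4 * (r s)\<^sup>2) - 1 / (2 * r s)) * r'"
      using assms(3) by (simp add: field_simps power2_eq_square)
    then show ?thesis
      by (simp only: kern1_def kern2_def alg2)
  qed
  ultimately show ?thesis by (simp only:)
qed

text \<open>Space derivatives of the kernel solve the heat equation too, so the coefficient of r' is
  the third derivative \<open>kern3\<close>.\<close>

lemma DERIV_kern1:
  assumes d: "(d has_real_derivative d') (at s within S)"
    and r: "(r has_real_derivative r') (at s within S)" and pos: "r s > 0"
  shows "((\<lambda>s. kern1 (d s) (r s)) has_real_derivative
           - kern2 (d s) (r s) * d' + kern3 (d s) (r s) * r') (at s within S)"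
proof -
  have "((\<lambda>s. d s / (2 * r s)) has_real_derivative (d' / (2 * r s) - d s * r' / (2 * (r s)\<^sup>2))) (at s within S)"
    using pos by (auto intro!: derivative_eq_intros d r simp: field_simps power2_eq_square)
  from DERIV_mult[OF this DERIV_kern[OF d r pos]]
  have "((\<lambda>s. kern1 (d s) (r s)) has_real_derivative
     (d' / (2 * r s) - d s * r' / (2 * (r s)\<^sup>2)) * kern (d s) (r s)
      + (- kern1 (d s) (r s) * d' + kern2 (d s) (r s) * r') * (d s / (2 * r s))) (at s within S)"
    by (simp add: kern1_def)
  moreover have "(d' / (2 * r s) - d s * r' / (2 * (r s)\<^sup>2)) * kern (d s) (r s)
      + (- kern1 (d s) (r s) * d' + kern2 (d s) (r s) * r') * (d s / (2 * r s))
     = - kern2 (d s) (r s) * d' + kern3 (d s) (r s) * r'"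
    using pos unfolding kern1_def kern2_def kern3_def
    by (simp add: field_simps power2_eq_square power3_eq_cube)
  ultimately show ?thesis by simp
qed

lemma DERIV_kern2_space:
  assumes d: "(d has_real_derivative d') (at s within S)" and pos: "r > 0"
  shows "((\<lambda>s. kern2 (d s) r) has_real_derivative - kern3 (d s) r * d') (at s within S)"
proof -
  have "((\<lambda>s. (d s)\<^sup>2 / (4 * r\<^sup>2) - 1 / (2 * r)) has_real_derivative (d s * d' / (2 * r\<^sup>2))) (at s within S)"
    using pos by (auto intro!: derivative_eq_intros d simp: field_simps power2_eq_square)
  from DERIV_mult[OF this DERIV_kern[OF d DERIV_const pos]]
  have "((\<lambda>s. kern2 (d s) r) has_real_derivative
     (d s * d' / (2 * r\<^sup>2)) * kern (d s) r
      + (- kern1 (d s) r * d') * ((d s)\<^sup>2 / (4 * r\<^sup>2) - 1 / (2 * r))) (at s within S)"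
    by (simp add: kern2_def)
  moreover have "(d s * d' / (2 * r\<^sup>2)) * kern (d s) r
      + (- kern1 (d s) r * d') * ((d s)\<^sup>2 / (4 * r\<^sup>2) - 1 / (2 * r))
     = - kern3 (d s) r * d'"
    using pos unfolding kern1_def kern2_def kern3_def
    by (simp add: field_simps power2_eq_square power3_eq_cube)
  ultimately show ?thesis by simp
qed

lemma continuous_on_kern [continuous_intros]:
  assumes "continuous_on S d" "continuous_on S r" "\<And>x. x \<in> S \<Longrightarrow> r x > (0 :: real)"
  shows "continuous_on S (\<lambda>x. kern (d x) (r x))"
  unfolding kern_def by (intro continuous_intros assms) (use assms(3) in force)+

lemma continuous_on_kern1 [continuous_intros]:
  assumes "continuous_on S d" "continuous_on S r" "\<And>x. x \<in> S \<Longrightarrow> r x > (0 :: real)"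
  shows "continuous_on S (\<lambda>x. kern1 (d x) (r x))"
  unfolding kern1_def by (intro continuous_intros assms) (use assms(3) in force)+

lemma continuous_on_kern2 [continuous_intros]:
  assumes "continuous_on S d" "continuous_on S r" "\<And>x. x \<in> S \<Longrightarrow> r x > (0 :: real)"
  shows "continuous_on S (\<lambda>x. kern2 (d x) (r x))"
  unfolding kern2_def by (intro continuous_intros assms) (use assms(3) in force)+

lemma continuous_on_kern3 [continuous_intros]:
  assumes "continuous_on S d" "continuous_on S r" "\<And>x. x \<in> S \<Longrightarrow> r x > (0 :: real)"
  shows "continuous_on S (\<lambda>x. kern3 (d x) (r x))"
  unfolding kern3_def by (intro continuous_intros assms) (use assms(3) in force)+

lemma kern_nonneg: "r > 0 \<Longrightarrow> kern d r \<ge> 0"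
  by (simp add: kern_def)

lemma kern_le: "r > 0 \<Longrightarrow> kern d r \<le> 1 / sqrt r"
  by (auto simp: kern_def intro!: divide_right_mono)

text \<open>Here \<open>\<Delta>\<close> is the signed distance of the two boundary points at time \<open>t\<close>.  For \<open>\<Delta> = 0\<close> the convention
  \<open>8 / 0 = 0\<close> makes the same bound cover the diagonal kernels.\<close>

lemma kern1_abs_le:
  assumes "r > 0" and "\<bar>d - \<Delta>\<bar> \<le> C * r" and "C \<ge> 0"
  shows "\<bar>kern1 d r\<bar> \<le> (3 * C + 8 / \<bar>\<Delta>\<bar>) / sqrt r"
proof -
  define E where "E = exp (- (d\<^sup>2 / (4 * r)))"
  have E: "0 < E" "E \<le> 1" using assms by (auto simp: E_def)
  have "\<bar>d\<bar> / r * E \<le> 3 * C + 8 / \<bar>\<Delta>\<bar>"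
  \<comment> \<open>Up to the threshold 3Cr the quotient |d|/r is bounded outright. Beyond it,
    |\<Delta>| > 2Cr, so |d| exceeds |\<Delta>|/2 and the exponential compensates for 1/r.\<close>
  proof (cases "\<bar>d\<bar> \<le> 3 * (C * r)")
    case True
    then have "\<bar>d\<bar> / r \<le> 3 * C" using assms by (simp add: field_simps)
    moreover have "\<bar>d\<bar> / r * E \<le> \<bar>d\<bar> / r * 1"
      using E assms by (intro mult_left_mono) auto
    ultimately show ?thesis by (smt (verit) divide_nonneg_nonneg abs_ge_zero)
  next
    case False
    have Cr: "0 \<le> C * r" using assms by simp
    have D: "\<bar>\<Delta>\<bar> / 2 \<le> \<bar>d\<bar>" "\<bar>\<Delta>\<bar> > 0" using False assms(2) Cr by linarith+
    then have d: "\<bar>d\<bar> > 0" by linarith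
    \<comment> \<open>This is x exp(-x) \<le> 1 for x = d^2/(4r). Dividing by |d|/4 gives the bound
      4/|d|, hence 8/|\<Delta>|.\<close>
    have "d\<^sup>2 / (4 * r) * E \<le> 1"
    proof -
      have "d\<^sup>2 / (4 * r) \<le> exp (d\<^sup>2 / (4 * r))"
        using exp_ge_add_one_self[of "d\<^sup>2 / (4 * r)"] by linarith
      then have "d\<^sup>2 / (4 * r) * E \<le> exp (d\<^sup>2 / (4 * r)) * E"
        using E by (intro mult_right_mono) auto
      also have "\<dots> = 1" by (simp add: E_def exp_minus_inverse)
      finally show ?thesis .
    qed
    then have "\<bar>d\<bar> / r * E * (\<bar>d\<bar> / 4) \<le> 1"
      by (cases "d \<ge> 0") (auto simp: power2_eq_square mult_ac)
    then have "\<bar>d\<bar> / r * E \<le> 4 / \<bar>d\<bar>"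
      using d by (simp add: field_simps)
    also have "\<dots> \<le> 8 / \<bar>\<Delta>\<bar>"
      using d D by (simp add: field_simps)
    finally show ?thesis using assms by simp
  qed
  moreover have "0 \<le> \<bar>d\<bar> / r * E"
    using E assms by simp
  moreover have "x / 2 \<le> K" if "x \<le> K" "0 \<le> x" for x K :: real
    using that by linarith
  ultimately have "\<bar>d\<bar> / r * E / 2 \<le> 3 * C + 8 / \<bar>\<Delta>\<bar>"
    by blast
  then have "\<bar>d\<bar> / r * E / 2 / sqrt r \<le> (3 * C + 8 / \<bar>\<Delta>\<bar>) / sqrt r"
    using assms by (intro divide_right_mono) auto
  moreover have "\<bar>kern1 d r\<bar> = \<bar>d\<bar> / r * E / 2 / sqrt r"
    using assms E by (simp add: kern1_def kern_def E_def abs_mult)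
  ultimately show ?thesis by simp
qed

subsection \<open>Green's identity on the straightened domain\<close>

text \<open>The hypotheses of the theorem with L written as \<open>l2 0\<close>. A single function
  \<open>qx\<close> serves as interior derivative and as one-sided boundary derivative.\<close>

locale moving_heat_problem =
  fixes T :: real and l1 l2 l1' l2' q0 q0' f0 f0' g0 g0' f1 g1 :: "real \<Rightarrow> real"
    and q qx qt :: "real \<Rightarrow> real \<Rightarrow> real"
  assumes T_pos: "T > 0"
    and l1: "C1_on l1 l1' {0..T}" and l2: "C1_on l2 l2' {0..T}"
    and l_0: "l1 0 = 0" "0 \<le> l2 0"
    and l_less: "\<And>s. 0 < s \<Longrightarrow> s \<le> T \<Longrightarrow> l1 s < l2 s"
    and q0: "C1_on q0 q0' {0..l2 0}"
    and f0: "C1_on f0 f0' {0..T}" and g0: "C1_on g0 g0' {0..T}"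
    and DERIV_t: "\<And>x t. (x, t) \<in> moving_domain l1 l2 T \<Longrightarrow>
        ((\<lambda>s. q x s) has_real_derivative qt x t) (at t)"
    \<comment> \<open>the heat equation, with \<open>q\<^sub>x\<^sub>x\<close> eliminated\<close>
    and DERIV_xx: "\<And>x t. (x, t) \<in> moving_domain l1 l2 T \<Longrightarrow>
        ((\<lambda>y. qx y t) has_real_derivative qt x t) (at x)"
    and cont_qt: "continuous_on (moving_domain l1 l2 T) (\<lambda>(x, t). qt x t)"
    and regular: "regular_up_to_boundary l1 l2 T q qx"
    and q_initial: "\<And>x. 0 < x \<Longrightarrow> x < l2 0 \<Longrightarrow> q x 0 = q0 x"
    and q_left: "\<And>t. 0 < t \<Longrightarrow> t < T \<Longrightarrow> q (l1 t) t = f0 t"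
    and q_right: "\<And>t. 0 < t \<Longrightarrow> t < T \<Longrightarrow> q (l2 t) t = g0 t"
    and cont_f1: "continuous_on {0..T} f1" and cont_g1: "continuous_on {0..T} g1"
    and qx_left: "\<And>t. 0 < t \<Longrightarrow> t < T \<Longrightarrow> qx (l1 t) t = f1 t"
    and qx_right: "\<And>t. 0 < t \<Longrightarrow> t < T \<Longrightarrow> qx (l2 t) t = g1 t"
begin

section \<open>Straightened coordinates and regularity of the data in them\<close>

abbreviation D :: "(real \<times> real) set" where
  "D \<equiv> moving_domain l1 l2 T"

definition W :: "real \<Rightarrow> real" where "W s = l2 s - l1 s"
definition W' :: "real \<Rightarrow> real" where "W' s = l2' s - l1' s"
text \<open>\<open>Y\<close> maps \<open>[0, 1]\<close> affinely onto \<open>[l1 s, l2 s]\<close>; \<open>Y'\<close> and \<open>W'\<close> are time derivatives.\<close>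

definition Y :: "real \<Rightarrow> real \<Rightarrow> real" where "Y x s = l1 s + x * W s"
definition Y' :: "real \<Rightarrow> real \<Rightarrow> real" where "Y' x s = l1' s + x * W' s"

lemma Y_0 [simp]: "Y 0 s = l1 s" "Y' 0 s = l1' s"
  and Y_1 [simp]: "Y 1 s = l2 s" "Y' 1 s = l2' s"
  by (auto simp: Y_def Y'_def W_def W'_def)

text \<open>The composition with an arbitrary u makes the facts applicable to functions of time
  alone and to functions on a rectangle, where u is a projection.\<close>

lemma continuous_on_data:
  assumes "continuous_on S u" "u ` S \<subseteq> {0..T}"
  shows "continuous_on S (\<lambda>x. l1 (u x))" "continuous_on S (\<lambda>x. l2 (u x))"
    "continuous_on S (\<lambda>x. l1' (u x))" "continuous_on S (\<lambda>x. l2' (u x))"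
    "continuous_on S (\<lambda>x. f0 (u x))" "continuous_on S (\<lambda>x. g0 (u x))"
    "continuous_on S (\<lambda>x. f0' (u x))" "continuous_on S (\<lambda>x. g0' (u x))"
    "continuous_on S (\<lambda>x. f1 (u x))" "continuous_on S (\<lambda>x. g1 (u x))"
    "continuous_on S (\<lambda>x. W (u x))" "continuous_on S (\<lambda>x. W' (u x))"
proof -
  have "continuous_on {0..T} l1" "continuous_on {0..T} l2"
    "continuous_on {0..T} f0" "continuous_on {0..T} g0"
    using l1 l2 f0 g0 by (auto simp: C1_on_def intro!: DERIV_continuous_on)
  moreover have "continuous_on {0..T} l1'" "continuous_on {0..T} l2'"
    "continuous_on {0..T} f0'" "continuous_on {0..T} g0'"
    using l1 l2 f0 g0 by (auto simp: C1_on_def)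
  moreover from calculation have "continuous_on {0..T} W" "continuous_on {0..T} W'"
    unfolding W_def W'_def by (auto intro: continuous_on_diff)
  ultimately show "continuous_on S (\<lambda>x. l1 (u x))" "continuous_on S (\<lambda>x. l2 (u x))"
    "continuous_on S (\<lambda>x. l1' (u x))" "continuous_on S (\<lambda>x. l2' (u x))"
    "continuous_on S (\<lambda>x. f0 (u x))" "continuous_on S (\<lambda>x. g0 (u x))"
    "continuous_on S (\<lambda>x. f0' (u x))" "continuous_on S (\<lambda>x. g0' (u x))"
    "continuous_on S (\<lambda>x. f1 (u x))" "continuous_on S (\<lambda>x. g1 (u x))"
    "continuous_on S (\<lambda>x. W (u x))" "continuous_on S (\<lambda>x. W' (u x))"
    using cont_f1 cont_g1 by - (rule continuous_on_compose2[OF _ assms], assumption)+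
qed

lemma continuous_on_Y:
  assumes "continuous_on S u" "u ` S \<subseteq> {0..T}" "continuous_on S v"
  shows "continuous_on S (\<lambda>x. Y (v x) (u x))" "continuous_on S (\<lambda>x. Y' (v x) (u x))"
  unfolding Y_def Y'_def
  by (intro continuous_intros continuous_on_data assms)+

lemma W_nonneg: "0 \<le> s \<Longrightarrow> s \<le> T \<Longrightarrow> 0 \<le> W s"
  using l_less[of s] l_0 by (cases "s = 0") (auto simp: W_def)

lemma W_pos: "0 < s \<Longrightarrow> s \<le> T \<Longrightarrow> 0 < W s"
  using l_less[of s] by (auto simp: W_def)

lemma Y_bounds:
  assumes "0 \<le> x" "x \<le> 1" "0 \<le> s" "s \<le> T"
  shows "l1 s \<le> Y x s" "Y x s \<le> l2 s"
proof -
  have "0 \<le> x * W s" "x * W s \<le> 1 * W s"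
    using assms W_nonneg[of s] mult_right_mono[of x 1 "W s"] by auto
  then show "l1 s \<le> Y x s" "Y x s \<le> l2 s" by (auto simp: Y_def W_def)
qed

lemma Y_in_D:
  assumes "0 < x" "x < 1" "0 < s" "s < T"
  shows "(Y x s, s) \<in> D"
proof -
  have "0 < x * W s" "x * W s < 1 * W s"
    using assms W_pos[of s] by (auto simp del: mult_1)
  then show ?thesis using assms by (auto simp: Y_def W_def moving_domain_def)
qed

text \<open>D is the intersection of two preimages of the positive half line under functions
  continuous on an open strip. Openness is what the chain rule along curves requires.\<close>

lemma open_D: "open D"
proof -
  have c: "continuous_on (UNIV \<times> {0<..<T}) (\<lambda>p. fst p - l1 (snd p))"
    "continuous_on (UNIV \<times> {0<..<T}) (\<lambda>p. l2 (snd p) - fst p)"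
    by (auto intro!: continuous_intros continuous_on_data)
  have "open (UNIV \<times> {0<..<T})" by (intro open_Times) auto
  from continuous_open_preimage[OF c(1) this, of "{0<..}"]
    continuous_open_preimage[OF c(2) this, of "{0<..}"]
  have "open (UNIV \<times> {0<..<T} \<inter> (\<lambda>p. fst p - l1 (snd p)) -` {0<..})"
    "open (UNIV \<times> {0<..<T} \<inter> (\<lambda>p. l2 (snd p) - fst p) -` {0<..})"
    by simp_all
  from open_Int[OF this]
  have "open {(x, t). 0 < t \<and> t < T \<and> l1 t < x \<and> x < l2 t}"
    by (rule subst[where P = "\<lambda>S. open S", rotated]) auto
  then show ?thesis by (simp add: moving_domain_def)
qed

lemma continuous_on_q_Y:
  assumes "continuous_on S u" "u ` S \<subseteq> {0..<T}" "continuous_on S v" "v ` S \<subseteq> {0..1}"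
  shows "continuous_on S (\<lambda>x. q (Y (v x) (u x)) (u x))"
proof -
  have uT: "u ` S \<subseteq> {0..T}" using assms(2) by force
  have "continuous_on {(x, t). 0 \<le> t \<and> t < T \<and> l1 t \<le> x \<and> x \<le> l2 t} (\<lambda>(x, t). q x t)"
    using regular by (auto simp: regular_up_to_boundary_def)
  moreover have "continuous_on S (\<lambda>x. (Y (v x) (u x), u x))"
    by (intro continuous_intros continuous_on_Y assms uT)
  ultimately have "continuous_on S (\<lambda>x. (\<lambda>(x, t). q x t) (Y (v x) (u x), u x))"
    by (rule continuous_on_compose2) (use assms(2,4) in \<open>force intro: Y_bounds\<close>)
  then show ?thesis by simp
qed

lemma continuous_on_qx_Y:
  assumes "continuous_on S u" "u ` S \<subseteq> {0<..<T}" "continuous_on S v" "v ` S \<subseteq> {0..1}"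
  shows "continuous_on S (\<lambda>x. qx (Y (v x) (u x)) (u x))"
proof -
  have uT: "u ` S \<subseteq> {0..T}" using assms(2) by force
  have "continuous_on {(x, t). 0 < t \<and> t < T \<and> l1 t \<le> x \<and> x \<le> l2 t} (\<lambda>(x, t). qx x t)"
    using regular by (auto simp: regular_up_to_boundary_def)
  moreover have "continuous_on S (\<lambda>x. (Y (v x) (u x), u x))"
    by (intro continuous_intros continuous_on_Y assms uT)
  ultimately have "continuous_on S (\<lambda>x. (\<lambda>(x, t). qx x t) (Y (v x) (u x), u x))"
    by (rule continuous_on_compose2) (use assms(2,4) in \<open>force intro: Y_bounds\<close>)
  then show ?thesis by simp
qed

lemma continuous_on_qt_Y:
  assumes "continuous_on S u" "u ` S \<subseteq> {0<..<T}" "continuous_on S v" "v ` S \<subseteq> {0<..<1}"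
  shows "continuous_on S (\<lambda>x. qt (Y (v x) (u x)) (u x))"
proof -
  have uT: "u ` S \<subseteq> {0..T}" using assms(2) by force
  have "continuous_on S (\<lambda>x. (Y (v x) (u x), u x))"
    by (intro continuous_intros continuous_on_Y assms uT)
  with cont_qt have "continuous_on S (\<lambda>x. (\<lambda>(x, t). qt x t) (Y (v x) (u x), u x))"
    by (rule continuous_on_compose2) (use assms(2,4) in \<open>force intro: Y_in_D\<close>)
  then show ?thesis by simp
qed

lemma DERIV_x:
  assumes "(x, t) \<in> D"
  shows "((\<lambda>y. q y t) has_real_derivative qx x t) (at x)"
proof -
  have x: "l1 t < x" "x < l2 t" "0 < t" "t < T"
    using assms by (auto simp: moving_domain_def)
  then have "((\<lambda>y. q y t) has_real_derivative qx x t) (at x within {l1 t..l2 t})"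
    using regular by (auto simp: regular_up_to_boundary_def)
  moreover have "at x within {l1 t..l2 t} = at x"
    using x by (intro at_within_interior) (simp add: interior_atLeastAtMost_real)
  ultimately show ?thesis by simp
qed

lemma DERIV_l:
  assumes "0 < s" "s < T"
  shows "(l1 has_real_derivative l1' s) (at s)" "(l2 has_real_derivative l2' s) (at s)"
proof -
  have "at s within {0..T} = at s"
    using assms by (intro at_within_interior) (simp add: interior_atLeastAtMost_real)
  moreover have "(l1 has_real_derivative l1' s) (at s within {0..T})"
    "(l2 has_real_derivative l2' s) (at s within {0..T})"
    using l1 l2 assms by (auto simp: C1_on_def)
  ultimately show "(l1 has_real_derivative l1' s) (at s)" "(l2 has_real_derivative l2' s) (at s)"
    by simp_all
qed

lemma DERIV_W:
  assumes "0 < s" "s < T"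
  shows "(W has_real_derivative W' s) (at s)"
  unfolding W_def W'_def by (intro derivative_intros DERIV_l assms)

lemma DERIV_Y_time:
  assumes "0 < s" "s < T"
  shows "((\<lambda>s. Y x s) has_real_derivative Y' x s) (at s)"
  unfolding Y_def Y'_def
  by (auto intro!: derivative_eq_intros DERIV_l DERIV_W assms)

lemma DERIV_Y_space:
  "((\<lambda>x. Y x s) has_real_derivative W s) (at x within S)"
  "((\<lambda>x. Y' x s) has_real_derivative W' s) (at x within S)"
  unfolding Y_def Y'_def by (auto intro!: derivative_eq_intros)

lemma DERIV_q_Y_time:
  assumes "0 < x" "x < 1" "0 < s" "s < T"
  shows "((\<lambda>s. q (Y x s) s) has_real_derivative qt (Y x s) s + qx (Y x s) s * Y' x s) (at s)"
  by (rule DERIV_along_curve[OF open_D Y_in_D[OF assms] DERIV_t DERIV_x cont_qt DERIV_Y_time])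
     (use assms in auto)

lemma DERIV_q_Y_space:
  assumes "0 < x" "x < 1" "0 < s" "s < T"
  shows "((\<lambda>x. q (Y x s) s) has_real_derivative qx (Y x s) s * W s) (at x)"
    and "((\<lambda>x. qx (Y x s) s) has_real_derivative qt (Y x s) s * W s) (at x)"
  using DERIV_chain2[OF DERIV_x[OF Y_in_D[OF assms]] DERIV_Y_space(1)]
    DERIV_chain2[OF DERIV_xx[OF Y_in_D[OF assms]] DERIV_Y_space(1)] by simp_all

text \<open>With \<open>v\<close> as above, \<open>P\<close> is the density \<open>v\<^sub>y q\<close> pulled back by \<open>Y\<close>, \<open>Q\<close> the corresponding
  current, and \<open>R\<close> the common value of \<open>\<partial>\<^sub>s P\<close> and \<open>\<partial>\<^sub>x Q\<close>.\<close>

definition P :: "real \<Rightarrow> real \<Rightarrow> real \<Rightarrow> real \<Rightarrow> real" where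
  "P \<xi> t x s = kern1 (\<xi> - Y x s) (t - s) * q (Y x s) s * W s"

definition Q :: "real \<Rightarrow> real \<Rightarrow> real \<Rightarrow> real \<Rightarrow> real" where
  "Q \<xi> t x s = kern1 (\<xi> - Y x s) (t - s) * (qx (Y x s) s + q (Y x s) s * Y' x s)
     - kern2 (\<xi> - Y x s) (t - s) * q (Y x s) s"

definition R :: "real \<Rightarrow> real \<Rightarrow> real \<Rightarrow> real \<Rightarrow> real" where
  "R \<xi> t x s =
     ((kern2 (\<xi> - Y x s) (t - s) * Y' x s - kern3 (\<xi> - Y x s) (t - s)) * q (Y x s) s
      + (qt (Y x s) s + qx (Y x s) s * Y' x s) * kern1 (\<xi> - Y x s) (t - s)) * W s
     + W' s * (kern1 (\<xi> - Y x s) (t - s) * q (Y x s) s)"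

lemma DERIV_P_time:
  assumes "0 < x" "x < 1" "0 < s" "s < t" "t \<le> T"
  shows "((\<lambda>s. P \<xi> t x s) has_real_derivative R \<xi> t x s) (at s)"
proof -
  have s: "s < T" using assms by simp
  have d: "((\<lambda>s. \<xi> - Y x s) has_real_derivative 0 - Y' x s) (at s)"
    and r: "((\<lambda>s. t - s) has_real_derivative 0 - 1) (at s)"
    by (intro derivative_intros DERIV_Y_time assms s)+
  have "((\<lambda>s. kern1 (\<xi> - Y x s) (t - s)) has_real_derivative
      - kern2 (\<xi> - Y x s) (t - s) * (0 - Y' x s) + kern3 (\<xi> - Y x s) (t - s) * (0 - 1)) (at s)"
    using assms by (intro DERIV_kern1 d r) auto
  from DERIV_mult[OF DERIV_mult[OF this DERIV_q_Y_time[OF assms(1-3) s]] DERIV_W[OF assms(3) s]]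
  show ?thesis unfolding P_def R_def by simp
qed

text \<open>The two products of \<open>kern2\<close> and \<open>qx\<close> cancel, and the heat
  equation has replaced the second derivative of q by \<open>qt\<close>. What remains is exactly the
  time derivative of \<open>P\<close>; the terms with \<open>Y'\<close> and \<open>W'\<close> come
  from the motion of the domain.\<close>

lemma DERIV_Q_space:
  assumes "0 < x" "x < 1" "0 < s" "s < t" "t \<le> T"
  shows "((\<lambda>x. Q \<xi> t x s) has_real_derivative R \<xi> t x s) (at x)"
proof -
  have s: "s < T" and ts: "t - s > 0" using assms by simp_all
  have d: "((\<lambda>x. \<xi> - Y x s) has_real_derivative 0 - W s) (at x)"
    by (intro derivative_intros DERIV_Y_space)
  have k1: "((\<lambda>x. kern1 (\<xi> - Y x s) (t - s)) has_real_derivative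
      kern2 (\<xi> - Y x s) (t - s) * W s) (at x)"
    using DERIV_kern1[OF d DERIV_const ts] by simp
  have k2: "((\<lambda>x. kern2 (\<xi> - Y x s) (t - s)) has_real_derivative
      kern3 (\<xi> - Y x s) (t - s) * W s) (at x)"
    using DERIV_kern2_space[OF d ts] by simp
  note q = DERIV_q_Y_space[OF assms(1-3) s]
  have "((\<lambda>x. Q \<xi> t x s) has_real_derivative
     kern2 (\<xi> - Y x s) (t - s) * W s * (qx (Y x s) s + q (Y x s) s * Y' x s)
     + (qt (Y x s) s * W s + (qx (Y x s) s * W s * Y' x s + W' s * q (Y x s) s)) * kern1 (\<xi> - Y x s) (t - s)
     - (kern3 (\<xi> - Y x s) (t - s) * W s * q (Y x s) s
        + qx (Y x s) s * W s * kern2 (\<xi> - Y x s) (t - s))) (at x)"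
    unfolding Q_def
    by (intro DERIV_diff DERIV_mult DERIV_add k1 k2 q DERIV_Y_space)
  then show ?thesis
    by (rule DERIV_cong) (simp add: R_def algebra_simps)
qed

lemma continuous_on_P:
  assumes "t \<le> T" "continuous_on S u" "u ` S \<subseteq> {0..<t}" "continuous_on S v" "v ` S \<subseteq> {0..1}"
  shows "continuous_on S (\<lambda>x. P \<xi> t (v x) (u x))"
proof -
  have u: "u ` S \<subseteq> {0..T}" "u ` S \<subseteq> {0..<T}" using assms by force+
  show ?thesis
    unfolding P_def
    by (intro continuous_intros continuous_on_q_Y continuous_on_Y continuous_on_data assms u)
       (use assms(3) in force)
qed

lemma continuous_on_Q:
  assumes "t \<le> T" "continuous_on S u" "u ` S \<subseteq> {0<..<t}" "continuous_on S v" "v ` S \<subseteq> {0..1}"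
  shows "continuous_on S (\<lambda>x. Q \<xi> t (v x) (u x))"
proof -
  have u: "u ` S \<subseteq> {0..T}" "u ` S \<subseteq> {0..<T}" "u ` S \<subseteq> {0<..<T}" using assms by force+
  show ?thesis
    unfolding Q_def
    by (intro continuous_intros continuous_on_q_Y continuous_on_qx_Y continuous_on_Y
         continuous_on_data assms u)
       (use assms(3) in force)+
qed

lemma continuous_on_R:
  assumes "t \<le> T" "continuous_on S u" "u ` S \<subseteq> {0<..<t}" "continuous_on S v" "v ` S \<subseteq> {0<..<1}"
  shows "continuous_on S (\<lambda>x. R \<xi> t (v x) (u x))"
proof -
  have u: "u ` S \<subseteq> {0..T}" "u ` S \<subseteq> {0..<T}" "u ` S \<subseteq> {0<..<T}" "v ` S \<subseteq> {0..1}"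
    using assms by force+
  show ?thesis
    unfolding R_def
    by (intro continuous_intros continuous_on_q_Y continuous_on_qx_Y continuous_on_qt_Y continuous_on_Y
         continuous_on_data assms u)
       (use assms(3) in force)+
qed

text \<open>The restriction 0 < c keeps away from the initial line, where \<open>qx\<close> is not
  controlled, and d < t keeps away from the pole.\<close>

lemma green_identity:
  assumes "0 < c" "c \<le> d" "d < t" "t \<le> T"
  shows "integral {0..1} (\<lambda>x. P \<xi> t x d) - integral {0..1} (\<lambda>x. P \<xi> t x c)
    = integral {c..d} (\<lambda>s. Q \<xi> t 1 s - Q \<xi> t 0 s)"
proof (rule conservation_law_rectangle[where R = "R \<xi> t"])
  show "continuous_on ({0..1} \<times> {c..d}) (\<lambda>(x, s). P \<xi> t x s)"
    unfolding split_beta using assms by (intro continuous_on_P continuous_intros) auto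
  show "continuous_on ({0..1} \<times> {c..d}) (\<lambda>(x, s). Q \<xi> t x s)"
    unfolding split_beta using assms by (intro continuous_on_Q continuous_intros) auto
  show "continuous_on ({0<..<1} \<times> {c..d}) (\<lambda>(x, s). R \<xi> t x s)"
    unfolding split_beta using assms by (intro continuous_on_R continuous_intros) auto
qed (use assms in \<open>auto intro!: DERIV_P_time DERIV_Q_space\<close>)

section \<open>The boundary flux and the balance law for \<open>\<Phi>\<close>\<close>

text \<open>Right boundary minus left boundary, after the Dirichlet values have been traded for
  their derivatives. Only the integrable singularities of \<open>kern\<close> and
  \<open>kern1\<close> remain.\<close>

definition flux :: "real \<Rightarrow> real \<Rightarrow> real \<Rightarrow> real" where
  "flux \<xi> t s = kern1 (\<xi> - l2 s) (t - s) * g1 s - kern1 (\<xi> - l1 s) (t - s) * f1 s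
     - kern (\<xi> - l2 s) (t - s) * g0' s + kern (\<xi> - l1 s) (t - s) * f0' s"

text \<open>Unlike \<open>\<integral> v q\<^sub>y dy\<close>, which it equals for positive times, this expression only involves \<open>q\<close>
  and is therefore continuous up to \<open>s = 0\<close>.\<close>

definition \<Phi> :: "real \<Rightarrow> real \<Rightarrow> real \<Rightarrow> real" where
  "\<Phi> \<xi> t s = kern (\<xi> - l2 s) (t - s) * q (l2 s) s - kern (\<xi> - l1 s) (t - s) * q (l1 s) s
     - integral {0..1} (\<lambda>x. P \<xi> t x s)"

text \<open>The integrand is the derivative of the kernel times f along the curve s \<mapsto> (l s,
  s). It absorbs the terms of \<open>Q\<close> with undifferentiated boundary values, in particular
  \<open>kern2\<close>, which for a pole on the same curve grows like (t - s)^(-3/2).\<close>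

lemma boundary_parts:
  fixes l l' f f' :: "real \<Rightarrow> real"
  assumes "C1_on l l' {0..T}" "C1_on f f' {0..T}" "0 \<le> c" "c \<le> d" "d < t" "t \<le> T"
  shows "((\<lambda>s. (kern1 (\<xi> - l s) (t - s) * l' s - kern2 (\<xi> - l s) (t - s)) * f s
            + f' s * kern (\<xi> - l s) (t - s))
     has_integral kern (\<xi> - l d) (t - d) * f d - kern (\<xi> - l c) (t - c) * f c) {c..d}"
proof (rule fundamental_theorem_of_calculus[OF \<open>c \<le> d\<close>])
  fix s assume s: "s \<in> {c..d}"
  have sub: "{c..d} \<subseteq> {0..T}" using assms by auto
  have "(l has_real_derivative l' s) (at s within {0..T})"
    and "(f has_real_derivative f' s) (at s within {0..T})"
    using assms(1,2) s sub by (auto simp: C1_on_def)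
  note l = DERIV_subset[OF this(1) sub] and f = DERIV_subset[OF this(2) sub]
  have d: "((\<lambda>s. \<xi> - l s) has_real_derivative 0 - l' s) (at s within {c..d})"
    and r: "((\<lambda>s. t - s) has_real_derivative 0 - 1) (at s within {c..d})"
    by (intro derivative_intros l)+
  have "((\<lambda>s. kern (\<xi> - l s) (t - s)) has_real_derivative
     - kern1 (\<xi> - l s) (t - s) * (0 - l' s) + kern2 (\<xi> - l s) (t - s) * (0 - 1)) (at s within {c..d})"
    using assms s by (intro DERIV_kern d r) auto
  from DERIV_mult[OF this f]
  show "((\<lambda>s. kern (\<xi> - l s) (t - s) * f s) has_vector_derivative
     (kern1 (\<xi> - l s) (t - s) * l' s - kern2 (\<xi> - l s) (t - s)) * f s
            + f' s * kern (\<xi> - l s) (t - s)) (at s within {c..d})"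
    by (simp flip: has_real_derivative_iff_has_vector_derivative)
qed

lemma continuous_on_flux:
  assumes "t \<le> T" "S \<subseteq> {0..<t}"
  shows "continuous_on S (flux \<xi> t)"
proof -
  note * = continuous_on_data[of S "\<lambda>x. x"]
  have S: "(\<lambda>x. x) ` S \<subseteq> {0..T}" using assms by force
  show ?thesis
    unfolding flux_def
    by (intro continuous_intros * S) (use assms in force)+
qed

lemma \<Phi>_diff:
  assumes "0 < c" "c \<le> d" "d < t" "t \<le> T"
  shows "\<Phi> \<xi> t c - \<Phi> \<xi> t d = integral {c..d} (flux \<xi> t)"
proof -
  have i1: "flux \<xi> t integrable_on {c..d}"
    using assms by (intro integrable_continuous_real continuous_on_flux) auto
  note b = boundary_parts[OF l2 g0 less_imp_le[OF assms(1)] assms(2-4), of \<xi>]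
    boundary_parts[OF l1 f0 less_imp_le[OF assms(1)] assms(2-4), of \<xi>]
  \<comment> \<open>The current at the two ends is the flux plus exact time derivatives; the latter
    supply the boundary terms in the definition of \<open>\<Phi>\<close>.\<close>
  have "integral {c..d} (\<lambda>s. Q \<xi> t 1 s - Q \<xi> t 0 s)
     = integral {c..d} (flux \<xi> t)
       + ((kern (\<xi> - l2 d) (t - d) * g0 d - kern (\<xi> - l2 c) (t - c) * g0 c)
          - (kern (\<xi> - l1 d) (t - d) * f0 d - kern (\<xi> - l1 c) (t - c) * f0 c))"
  proof (rule integral_unique[OF has_integral_eq])
    show "((\<lambda>s. flux \<xi> t s + (((kern1 (\<xi> - l2 s) (t - s) * l2' s - kern2 (\<xi> - l2 s) (t - s)) * g0 s
            + g0' s * kern (\<xi> - l2 s) (t - s)) -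
           ((kern1 (\<xi> - l1 s) (t - s) * l1' s - kern2 (\<xi> - l1 s) (t - s)) * f0 s
            + f0' s * kern (\<xi> - l1 s) (t - s)))) has_integral integral {c..d} (flux \<xi> t)
       + ((kern (\<xi> - l2 d) (t - d) * g0 d - kern (\<xi> - l2 c) (t - c) * g0 c)
          - (kern (\<xi> - l1 d) (t - d) * f0 d - kern (\<xi> - l1 c) (t - c) * f0 c))) {c..d}"
      by (intro has_integral_add has_integral_diff b integrable_integral[OF i1])
  next
    fix s assume "s \<in> {c..d}"
    then have "0 < s" "s < T" using assms by auto
    then show "flux \<xi> t s + (((kern1 (\<xi> - l2 s) (t - s) * l2' s - kern2 (\<xi> - l2 s) (t - s)) * g0 s
            + g0' s * kern (\<xi> - l2 s) (t - s)) -
           ((kern1 (\<xi> - l1 s) (t - s) * l1' s - kern2 (\<xi> - l1 s) (t - s)) * f0 s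
            + f0' s * kern (\<xi> - l1 s) (t - s))) = Q \<xi> t 1 s - Q \<xi> t 0 s"
      by (simp add: Q_def flux_def q_left q_right qx_left qx_right algebra_simps)
  qed
  with green_identity[OF assms, of \<xi>] assms show ?thesis
    by (simp add: \<Phi>_def q_left q_right)
qed

lemma continuous_on_\<Phi>:
  assumes "t \<le> T"
  shows "continuous_on {0..<t} (\<Phi> \<xi> t)"
proof -
  have "continuous_on ({0..<t} \<times> cbox 0 1) (\<lambda>(s, x). P \<xi> t x s)"
    unfolding split_beta using assms by (intro continuous_on_P continuous_intros) auto
  from integral_continuous_on_param[OF this]
  have 1: "continuous_on {0..<t} (\<lambda>s. integral {0..1} (\<lambda>x. P \<xi> t x s))" by simp
  have T: "(\<lambda>x. x) ` {0..<t} \<subseteq> {0..<T}" "(\<lambda>x. x) ` {0..<t} \<subseteq> {0..T}" using assms by auto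
  have 2: "continuous_on {0..<t} (\<lambda>s. q (l1 s) s)" "continuous_on {0..<t} (\<lambda>s. q (l2 s) s)"
    using continuous_on_q_Y[OF _ T(1), of "\<lambda>_. 0"] continuous_on_q_Y[OF _ T(1), of "\<lambda>_. 1"]
    by (auto simp: image_subset_iff)
  show ?thesis
    unfolding \<Phi>_def
    by (intro continuous_intros 1 2 continuous_on_data T) auto
qed

text \<open>The difference of \<open>\<Phi>\<close> at c and the flux over [c, d] is constant for 0
  < c < d and continuous down to c = 0. The flux is continuous there because f1 and g1 are.\<close>

lemma \<Phi>_diff_initial:
  assumes "0 < d" "d < t" "t \<le> T"
  shows "\<Phi> \<xi> t 0 - \<Phi> \<xi> t d = integral {0..d} (flux \<xi> t)"
proof -
  define F where "F = (\<lambda>c. \<Phi> \<xi> t c - integral {c..d} (flux \<xi> t))"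
  have "F 0 = \<Phi> \<xi> t d"
  proof (rule continuous_constant_on_closure[of "{0<..<d}" F])
    have closure: "closure {0<..<d} = {0..d}" using assms by simp
    have "flux \<xi> t integrable_on {0..d}"
      using assms by (intro integrable_continuous_real continuous_on_flux) auto
    note 1 = indefinite_integral_continuous_1'[OF this]
    have 2: "continuous_on {0..d} (\<Phi> \<xi> t)"
      by (rule continuous_on_subset[OF continuous_on_\<Phi>]) (use assms in auto)
    show "continuous_on (closure {0<..<d}) F"
      unfolding F_def closure by (intro continuous_on_diff 1 2)
    show "F c = \<Phi> \<xi> t d" if "c \<in> {0<..<d}" for c
      using \<Phi>_diff[of c d t \<xi>] that assms by (simp add: F_def)
    show "0 \<in> closure {0<..<d}" using assms closure by simp
  qed
  then show ?thesis by (simp add: F_def)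
qed

text \<open>Integration by parts in x: the integral of \<open>P\<close> moves the derivative from
  the kernel to q. The factor \<open>W\<close> is the Jacobian of \<open>Y\<close>.\<close>

lemma \<Phi>_eq_integral:
  assumes "0 < s" "s < t" "t \<le> T"
  shows "((\<lambda>x. kern (\<xi> - Y x s) (t - s) * qx (Y x s) s * W s) has_integral \<Phi> \<xi> t s) {0..1}"
proof -
  have s: "s < T" and ts: "t - s > 0" using assms by simp_all
  have "((\<lambda>x. kern1 (\<xi> - Y x s) (t - s) * W s * q (Y x s) s
          + qx (Y x s) s * W s * kern (\<xi> - Y x s) (t - s))
     has_integral kern (\<xi> - Y 1 s) (t - s) * q (Y 1 s) s - kern (\<xi> - Y 0 s) (t - s) * q (Y 0 s) s) {0..1}"
  proof (rule fundamental_theorem_of_calculus_interior)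
    show "continuous_on {0..1} (\<lambda>x. kern (\<xi> - Y x s) (t - s) * q (Y x s) s)"
      using assms by (intro continuous_intros continuous_on_Y continuous_on_q_Y) auto
    fix x :: real assume x: "x \<in> {0<..<1}"
    have d: "((\<lambda>x. \<xi> - Y x s) has_real_derivative 0 - W s) (at x)"
      by (intro derivative_intros DERIV_Y_space)
    have "((\<lambda>x. kern (\<xi> - Y x s) (t - s)) has_real_derivative
      kern1 (\<xi> - Y x s) (t - s) * W s) (at x)"
      using DERIV_kern[OF d DERIV_const ts] by simp
    from DERIV_mult[OF this DERIV_q_Y_space(1)[OF _ _ \<open>0 < s\<close> s]] x
    show "((\<lambda>x. kern (\<xi> - Y x s) (t - s) * q (Y x s) s) has_vector_derivative
       kern1 (\<xi> - Y x s) (t - s) * W s * q (Y x s) s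
          + qx (Y x s) s * W s * kern (\<xi> - Y x s) (t - s)) (at x)"
      by (simp flip: has_real_derivative_iff_has_vector_derivative)
  qed auto
  moreover have "((\<lambda>x. P \<xi> t x s) has_integral integral {0..1} (\<lambda>x. P \<xi> t x s)) {0..1}"
    using assms
    by (intro integrable_integral integrable_continuous_real continuous_on_P continuous_intros) auto
  ultimately have "((\<lambda>x. kern1 (\<xi> - Y x s) (t - s) * W s * q (Y x s) s
          + qx (Y x s) s * W s * kern (\<xi> - Y x s) (t - s) - P \<xi> t x s)
     has_integral \<Phi> \<xi> t s) {0..1}"
    by (auto simp: \<Phi>_def intro: has_integral_diff)
  then show ?thesis
    by (rule has_integral_eq[rotated]) (simp add: P_def algebra_simps)
qed

text \<open>The same integration by parts at s = 0, where q is known only through q0 and its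
  derivative is therefore \<open>q0'\<close>, followed by the substitution y = xL.\<close>

lemma \<Phi>_initial:
  assumes "0 < t" "t \<le> T"
  shows "\<Phi> \<xi> t 0 = integral {0..l2 0} (\<lambda>x. kern (\<xi> - x) t * q0' x)"
proof (cases "l2 0 = 0")
  \<comment> \<open>The interval is a point: the two boundary terms cancel and the factor
    \<open>W\<close> annihilates \<open>P\<close>.\<close>
  case True
  then show ?thesis using l_0 by (simp add: \<Phi>_def P_def W_def)
next
  case False
  define L where "L = l2 0"
  have L: "L > 0" using False l_0 by (simp add: L_def)
  have Y: "Y x 0 = x * L" "W 0 = L" for x using l_0 by (auto simp: Y_def W_def L_def)
  have cq: "continuous_on {0..1} (\<lambda>x. q (x * L) 0)"
    using continuous_on_q_Y[of "{0..1}" "\<lambda>_. 0" "\<lambda>x. x"] T_pos by (auto simp: Y image_subset_iff)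
  have "((\<lambda>x. kern1 (\<xi> - x * L) t * L * q (x * L) 0
          + q0' (x * L) * L * kern (\<xi> - x * L) t)
     has_integral kern (\<xi> - 1 * L) t * q (1 * L) 0 - kern (\<xi> - 0 * L) t * q (0 * L) 0) {0..1}"
  proof (rule fundamental_theorem_of_calculus_interior)
    show "continuous_on {0..1} (\<lambda>x. kern (\<xi> - x * L) t * q (x * L) 0)"
      using assms by (intro continuous_intros cq) auto
    fix x :: real assume x: "x \<in> {0<..<1}"
    have d: "((\<lambda>x. \<xi> - x * L) has_real_derivative - L) (at x)"
      by (auto intro!: derivative_eq_intros)
    have k: "((\<lambda>x. kern (\<xi> - x * L) t) has_real_derivative kern1 (\<xi> - x * L) t * L) (at x)"
      using DERIV_kern[OF d DERIV_const \<open>0 < t\<close>] by simp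
    have xL: "0 < x * L" "x * L < L" using x L by auto
    have "\<forall>y\<in>{0..L}. (q0 has_real_derivative q0' y) (at y within {0..L})"
      using q0 by (simp add: C1_on_def L_def)
    then have "(q0 has_real_derivative q0' (x * L)) (at (x * L) within {0..L})"
      by (rule bspec) (intro atLeastAtMost_iff[THEN iffD2] conjI less_imp_le xL)
    moreover have "at (x * L) within {0..L} = at (x * L)"
      by (intro at_within_interior)
        (simp only: interior_atLeastAtMost_real greaterThanLessThan_iff xL simp_thms)
    ultimately have "(q0 has_real_derivative q0' (x * L)) (at (x * L))" by simp
    \<comment> \<open>The initial condition holds on the open interval only, which suffices for the
      derivative at an interior point.\<close>
    then have "((\<lambda>x. q x 0) has_real_derivative q0' (x * L)) (at (x * L))"
      by (rule has_field_derivative_transform_within_open[of _ _ _ "{0<..<L}"])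
        (simp_all only: open_greaterThanLessThan greaterThanLessThan_iff xL simp_thms,
         simp add: q_initial L_def)
    then have "((\<lambda>x. q (x * L) 0) has_real_derivative q0' (x * L) * L) (at x)"
      by (rule DERIV_chain2) (auto intro!: derivative_eq_intros)
    from DERIV_mult[OF k this]
    show "((\<lambda>x. kern (\<xi> - x * L) t * q (x * L) 0) has_vector_derivative
       kern1 (\<xi> - x * L) t * L * q (x * L) 0
          + q0' (x * L) * L * kern (\<xi> - x * L) t) (at x)"
      by (simp flip: has_real_derivative_iff_has_vector_derivative)
  qed auto
  moreover have "((\<lambda>x. P \<xi> t x 0) has_integral integral {0..1} (\<lambda>x. P \<xi> t x 0)) {0..1}"
    using assms
    by (intro integrable_integral integrable_continuous_real continuous_on_P continuous_intros) auto
  ultimately have "((\<lambda>x. kern1 (\<xi> - x * L) t * L * q (x * L) 0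
          + q0' (x * L) * L * kern (\<xi> - x * L) t - P \<xi> t x 0)
     has_integral \<Phi> \<xi> t 0) {0..1}"
    using l_0 by (auto simp: \<Phi>_def L_def intro: has_integral_diff)
  then have 1: "((\<lambda>x. q0' (x * L) * L * kern (\<xi> - x * L) t) has_integral \<Phi> \<xi> t 0) {0..1}"
    by (rule has_integral_eq[rotated]) (simp add: P_def Y algebra_simps)
  have "continuous_on {0..L} q0'" using q0 by (simp add: C1_on_def L_def)
  then have "(\<lambda>x. kern (\<xi> - x) t * q0' x) integrable_on {0..L}"
    using assms by (intro integrable_continuous_real continuous_intros) auto
  from has_integral_stretch_real[OF integrable_integral[OF this], of L] L
  have "((\<lambda>x. L * (kern (\<xi> - L * x) t * q0' (L * x)))
      has_integral L * ((1 / L) * integral {0..L} (\<lambda>x. kern (\<xi> - x) t * q0' x))) {0..1}"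
    by (intro has_integral_mult_right) (simp add: image_divide_atLeastAtMost)
  then have "((\<lambda>x. q0' (x * L) * L * kern (\<xi> - x * L) t)
      has_integral integral {0..L} (\<lambda>x. kern (\<xi> - x) t * q0' x)) {0..1}"
    using L by (simp add: mult_ac)
  from has_integral_unique[OF 1 this] show ?thesis by (simp add: L_def)
qed

end

subsection \<open>Absolute integrability of the kernels\<close>

lemma heat_kernel_eq_kern: "heat_kernel lj lm t s = kern (lj t - lm s) (t - s)"
  by (simp add: heat_kernel_def kern_def)

lemma kernel_K_eq_kern1: "kernel_K lj lm t s = sqrt pi * kern1 (lj t - lm s) (t - s)"
  by (simp add: kernel_K_def heat_kernel_eq_kern kern1_def)

lemma bounded_on_compact_interval:
  fixes \<phi> :: "real \<Rightarrow> real"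
  assumes "continuous_on {a..b} \<phi>"
  obtains B where "B \<ge> 0" "\<And>s. s \<in> {a..b} \<Longrightarrow> \<bar>\<phi> s\<bar> \<le> B"
proof -
  have "bounded (\<phi> ` {a..b})"
    using assms by (intro compact_imp_bounded compact_continuous_image) auto
  then obtain B where "B > 0" "\<forall>x\<in>\<phi> ` {a..b}. norm x \<le> B"
    using bounded_pos by blast
  then show ?thesis by (intro that[of B]) auto
qed

lemma kern_absolutely_integrable:
  assumes "0 \<le> t" "continuous_on {0..t} l" "continuous_on {0..t} \<phi>"
  shows "(\<lambda>s. kern (\<xi> - l s) (t - s) * \<phi> s) absolutely_integrable_on {0..t}"
proof -
  obtain B where B: "B \<ge> 0" "\<And>s. s \<in> {0..t} \<Longrightarrow> \<bar>\<phi> s\<bar> \<le> B"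
    using bounded_on_compact_interval[OF assms(3)] by blast
  note c = assms(2,3)[THEN continuous_on_subset, of "{0..<t}"]
  show ?thesis
  proof (rule absolutely_integrable_inverse_sqrt_bound[OF assms(1)])
    show "continuous_on {0..<t} (\<lambda>s. kern (\<xi> - l s) (t - s) * \<phi> s)"
      by (intro continuous_intros c) auto
    show "\<bar>kern (\<xi> - l s) (t - s) * \<phi> s\<bar> \<le> B / sqrt (t - s)" if "0 \<le> s" "s < t" for s
    proof -
      have "\<bar>kern (\<xi> - l s) (t - s)\<bar> * \<bar>\<phi> s\<bar> \<le> 1 / sqrt (t - s) * B"
        using that B by (intro mult_mono) (auto simp: kern_nonneg kern_le)
      then show ?thesis by (simp add: abs_mult)
    qed
  qed
qed

text \<open>Apply \<open>kern1_abs_le\<close> with \<Delta> = \<open>\<xi> - l t\<close>: the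
  distance from the pole to the curve differs from \<Delta> by \<open>l t - l s\<close>, which is
  O(t - s). Poles on the curve and off it are treated alike.\<close>

lemma kern1_absolutely_integrable:
  assumes "0 \<le> t" "continuous_on {0..t} l" "continuous_on {0..t} \<phi>"
    and "C \<ge> 0" and lip: "\<And>s. s \<in> {0..t} \<Longrightarrow> \<bar>l t - l s\<bar> \<le> C * (t - s)"
  shows "(\<lambda>s. kern1 (\<xi> - l s) (t - s) * \<phi> s) absolutely_integrable_on {0..t}"
proof -
  obtain B where B: "B \<ge> 0" "\<And>s. s \<in> {0..t} \<Longrightarrow> \<bar>\<phi> s\<bar> \<le> B"
    using bounded_on_compact_interval[OF assms(3)] by blast
  note c = assms(2,3)[THEN continuous_on_subset, of "{0..<t}"]
  define E where "E = 3 * C + 8 / \<bar>\<xi> - l t\<bar>"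
  have "E \<ge> 0" using \<open>C \<ge> 0\<close> by (simp add: E_def)
  show ?thesis
  proof (rule absolutely_integrable_inverse_sqrt_bound[OF assms(1)])
    show "continuous_on {0..<t} (\<lambda>s. kern1 (\<xi> - l s) (t - s) * \<phi> s)"
      by (intro continuous_intros c) auto
    show "\<bar>kern1 (\<xi> - l s) (t - s) * \<phi> s\<bar> \<le> (E * B) / sqrt (t - s)" if "0 \<le> s" "s < t" for s
    proof -
      have "\<bar>kern1 (\<xi> - l s) (t - s)\<bar> \<le> E / sqrt (t - s)"
        unfolding E_def
        by (rule kern1_abs_le) (use that lip[of s] assms in auto)
      then have "\<bar>kern1 (\<xi> - l s) (t - s)\<bar> * \<bar>\<phi> s\<bar> \<le> E / sqrt (t - s) * B"
        using that B \<open>E \<ge> 0\<close> by (intro mult_mono) auto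
      then show ?thesis by (simp add: abs_mult)
    qed
  qed
qed

lemma C1_on_lipschitz:
  assumes "C1_on l l' {0..T}"
  obtains C where "C \<ge> 0" "\<And>s t. s \<in> {0..T} \<Longrightarrow> t \<in> {0..T} \<Longrightarrow> \<bar>l t - l s\<bar> \<le> C * \<bar>t - s\<bar>"
proof -
  obtain C where C: "C \<ge> 0" "\<And>s. s \<in> {0..T} \<Longrightarrow> \<bar>l' s\<bar> \<le> C"
    using assms bounded_on_compact_interval[of 0 T l'] by (auto simp: C1_on_def)
  have "norm (l t - l s) \<le> C * norm (t - s)" if "s \<in> {0..T}" "t \<in> {0..T}" for s t
    by (rule field_differentiable_bound[of "{0..T}" l l'])
       (use that assms C in \<open>auto simp: C1_on_def\<close>)
  with C(1) show ?thesis by (intro that[of C]) auto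
qed

text \<open>The origin is removed because the rescaled interval need not eventually contain or
  eventually miss z = 0; every other z is decided by its sign.\<close>

lemma half_gaussian_integrals:
  "((\<lambda>z. indicator {0..} z * exp (- z\<^sup>2)) has_integral sqrt pi / 2) (UNIV - {0 :: real})"
  "((\<lambda>z. indicator {..0} z * exp (- z\<^sup>2)) has_integral sqrt pi / 2) (UNIV - {0 :: real})"
proof -
  have spike: "(f has_integral i) (UNIV - {0})" if "has_bochner_integral lborel f i"
    for f :: "real \<Rightarrow> real" and i
  proof -
    have "(f has_integral i) UNIV"
      using that has_integral_integral_lborel[of f] by (auto simp: has_bochner_integral_iff)
    moreover have "negligible {x \<in> UNIV - (UNIV - {0}). f x \<noteq> 0}"
      "negligible {x \<in> (UNIV - {0}) - UNIV. f x \<noteq> 0}"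
      by (rule negligible_subset[of "{0}"]; force)+
    ultimately show ?thesis using has_integral_spike_set_eq by blast
  qed
  show "((\<lambda>z. indicator {0..} z * exp (- z\<^sup>2)) has_integral sqrt pi / 2) (UNIV - {0 :: real})"
    using spike[OF gaussian_moment_0] by simp
  \<comment> \<open>The left half is the reflection z \<mapsto> -z of the right half.\<close>
  have "has_bochner_integral lborel (\<lambda>z. indicator {0..} (0 + (-1) * z) *\<^sub>R exp (- (0 + (-1) * z)\<^sup>2))
     (sqrt pi / 2 /\<^sub>R \<bar>-1 :: real\<bar>)"
    using lborel_has_bochner_integral_real_affine_iff[of "-1" "\<lambda>z. indicator {0..} z *\<^sub>R exp (- z\<^sup>2)" "sqrt pi / 2" 0]
      gaussian_moment_0 by simp
  moreover have "indicator {0..} (0 + (-1) * z) = (indicator {..0} z :: real)" for z :: real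
    by (auto simp: indicator_def)
  ultimately show "((\<lambda>z. indicator {..0} z * exp (- z\<^sup>2)) has_integral sqrt pi / 2) (UNIV - {0 :: real})"
    using spike[of "\<lambda>z. indicator {..0} z * exp (- z\<^sup>2)" "sqrt pi / 2"] by simp
qed

subsection \<open>Limit at a pole on the boundary\<close>

context moving_heat_problem
begin

text \<open>Substitute y = \<xi> + 2 sqrt(t - s) z. The kernel becomes exp(-z^2)/sqrt(t - s), and
  the Jacobian cancels the singular factor up to the constant 2.\<close>

lemma \<Phi>_rescaled:
  assumes "0 < s" "s < t" "t \<le> T"
  shows "((\<lambda>z. 2 * exp (- z\<^sup>2) * qx (\<xi> + 2 * sqrt (t - s) * z) s) has_integral \<Phi> \<xi> t s)
     {(l1 s - \<xi>) / (2 * sqrt (t - s))..(l2 s - \<xi>) / (2 * sqrt (t - s))}"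
proof -
  define w where "w = W s"
  have w: "w > 0" using W_pos[of s] assms by (simp add: w_def)
  define r where "r = sqrt (t - s)"
  have r: "r > 0" "t - s = r\<^sup>2" using assms by (simp_all add: r_def)
  \<comment> \<open>The affine map z \<mapsto> m z + c is chosen so that \<open>Y\<close> sends its
    value to \<xi> + 2 r z.\<close>
  define m where "m = 2 * r / w"
  define c where "c = (\<xi> - l1 s) / w"
  have m: "m > 0" using w r by (simp add: m_def)
  have Y: "Y (m * z + c) s = \<xi> + 2 * r * z" for z
    using w by (simp add: Y_def m_def c_def field_simps flip: w_def)
  have kern: "kern (\<xi> - Y (m * z + c) s) (t - s) = exp (- z\<^sup>2) / r" for z
    using r by (simp add: Y kern_def power_mult_distrib)
  have "((\<lambda>x. kern (\<xi> - Y x s) (t - s) * qx (Y x s) s * W s) has_integral \<Phi> \<xi> t s) (cbox 0 1)"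
    using \<Phi>_eq_integral[OF assms] by simp
  from has_integral_affinity'[OF this m, of c]
  have "((\<lambda>z. kern (\<xi> - Y (m * z + c) s) (t - s) * qx (Y (m * z + c) s) s * w) has_integral
        \<Phi> \<xi> t s / m) {(0 - c) / m..(1 - c) / m}"
    by (simp add: w_def divide_inverse mult_ac)
  then have "((\<lambda>z. m * (kern (\<xi> - Y (m * z + c) s) (t - s) * qx (Y (m * z + c) s) s * w)) has_integral
        m * (\<Phi> \<xi> t s / m)) {(0 - c) / m..(1 - c) / m}"
    by (rule has_integral_mult_right)
  moreover have "m * (kern (\<xi> - Y (m * z + c) s) (t - s) * qx (Y (m * z + c) s) s * w)
      = 2 * exp (- z\<^sup>2) * qx (\<xi> + 2 * r * z) s" for z
    unfolding kern unfolding Y using w r by (simp add: m_def)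
  moreover have "(0 - c) / m = (l1 s - \<xi>) / (2 * r)"
    using w r by (simp add: m_def c_def field_simps)
  moreover have "1 - c = (l2 s - \<xi>) / w"
    using w by (simp add: c_def field_simps) (simp add: w_def W_def)
  then have "(1 - c) / m = (l2 s - \<xi>) / (2 * r)"
    using w r by (simp add: m_def)
  ultimately show ?thesis using m by (simp add: r_def)
qed

text \<open>The closed region between times a and b is the image of a compact rectangle under the
  straightening map. The bound a > 0 matters, as \<open>qx\<close> is not controlled near time
  0.\<close>

lemma qx_bounded:
  assumes "0 < a" "b < T"
  obtains M where "M \<ge> 0" "\<And>x s. a \<le> s \<Longrightarrow> s \<le> b \<Longrightarrow> l1 s \<le> x \<Longrightarrow> x \<le> l2 s \<Longrightarrow> \<bar>qx x s\<bar> \<le> M"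
proof -
  have "continuous_on ({0..1} \<times> {a..b}) (\<lambda>p. qx (Y (fst p) (snd p)) (snd p))"
    using assms by (intro continuous_on_qx_Y continuous_intros) auto
  then have "bounded ((\<lambda>p. qx (Y (fst p) (snd p)) (snd p)) ` ({0..1} \<times> {a..b}))"
    by (intro compact_imp_bounded compact_continuous_image compact_Times) auto
  then obtain M where M: "M > 0"
    "\<forall>y \<in> (\<lambda>p. qx (Y (fst p) (snd p)) (snd p)) ` ({0..1} \<times> {a..b}). norm y \<le> M"
    using bounded_pos by blast
  have "\<bar>qx x s\<bar> \<le> M" if "a \<le> s" "s \<le> b" "l1 s \<le> x" "x \<le> l2 s" for x s
  proof -
    define \<theta> where "\<theta> = (x - l1 s) / W s"
    have "W s > 0" using W_pos[of s] assms that by auto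
    then have "Y \<theta> s = x" "\<theta> \<in> {0..1}"
      using that by (auto simp: \<theta>_def Y_def W_def)
    then show ?thesis using M(2) that by force
  qed
  with M(1) show ?thesis by (intro that[of M]) auto
qed

text \<open>The weight \<open>p\<close> is the Gaussian restricted to the half line that the rescaled intervals exhaust.\<close>

lemma \<Phi>_limit:
  fixes p :: "real \<Rightarrow> real" and \<tau> :: "nat \<Rightarrow> real"
  assumes "0 < t" "t < T" "l1 t \<le> \<xi>" "\<xi> \<le> l2 t"
    and \<tau>: "\<tau> \<longlonglongrightarrow> t" "\<And>n. t / 2 \<le> \<tau> n" "\<And>n. \<tau> n < t"
    and p: "(p has_integral sqrt pi / 2) (UNIV - {0})"
    and pointwise: "\<And>z. z \<noteq> 0 \<Longrightarrow>
       p z = exp (- z\<^sup>2) \<and>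
         (\<forall>\<^sub>F n in sequentially. \<xi> + 2 * sqrt (t - \<tau> n) * z \<in> {l1 (\<tau> n)..l2 (\<tau> n)}) \<or>
       p z = 0 \<and>
         (\<forall>\<^sub>F n in sequentially. \<xi> + 2 * sqrt (t - \<tau> n) * z \<notin> {l1 (\<tau> n)..l2 (\<tau> n)})"
  shows "(\<lambda>n. \<Phi> \<xi> t (\<tau> n)) \<longlonglongrightarrow> sqrt pi * qx \<xi> t"
proof -
  obtain M where M: "M \<ge> 0"
    "\<And>x s. t / 2 \<le> s \<Longrightarrow> s \<le> t \<Longrightarrow> l1 s \<le> x \<Longrightarrow> x \<le> l2 s \<Longrightarrow> \<bar>qx x s\<bar> \<le> M"
    using qx_bounded[of "t / 2" t] assms(1,2) by auto
  define y where "y = (\<lambda>n z. \<xi> + 2 * sqrt (t - \<tau> n) * z)"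
  \<comment> \<open>Extension by zero puts all the integrals on one fixed set, as dominated
    convergence requires.\<close>
  define g where "g = (\<lambda>n z. if y n z \<in> {l1 (\<tau> n)..l2 (\<tau> n)}
      then 2 * exp (- z\<^sup>2) * qx (y n z) (\<tau> n) else 0)"
  have \<tau>0: "0 < \<tau> n" for n using \<tau>(2)[of n] \<open>0 < t\<close> by linarith
  have g: "(g n has_integral \<Phi> \<xi> t (\<tau> n)) (UNIV - {0})" for n
  proof -
    have r: "sqrt (t - \<tau> n) > 0" using \<tau>(3)[of n] by simp
    let ?I = "{(l1 (\<tau> n) - \<xi>) / (2 * sqrt (t - \<tau> n))..(l2 (\<tau> n) - \<xi>) / (2 * sqrt (t - \<tau> n))}"
    have I: "z \<in> ?I \<longleftrightarrow> y n z \<in> {l1 (\<tau> n)..l2 (\<tau> n)}" for z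
      using r by (auto simp: y_def field_simps)
    have "((\<lambda>z. if z \<in> ?I then 2 * exp (- z\<^sup>2) * qx (y n z) (\<tau> n) else 0)
        has_integral \<Phi> \<xi> t (\<tau> n)) UNIV"
      unfolding y_def has_integral_restrict_UNIV
      using assms \<tau>0 by (intro \<Phi>_rescaled) auto
    then have "(g n has_integral \<Phi> \<xi> t (\<tau> n)) UNIV"
      by (simp only: I g_def)
    moreover have "negligible {x \<in> UNIV - (UNIV - {0}). g n x \<noteq> 0}"
      "negligible {x \<in> (UNIV - {0}) - UNIV. g n x \<noteq> 0}"
      by (rule negligible_subset[of "{0}"]; force)+
    ultimately show ?thesis using has_integral_spike_set_eq by blast
  qed
  have "(\<lambda>n. integral (UNIV - {0}) (g n)) \<longlonglongrightarrow> integral (UNIV - {0}) (\<lambda>z. 2 * qx \<xi> t * p z)"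
  proof (rule dominated_convergence(2))
    show "g n integrable_on UNIV - {0}" for n using g by blast
    \<comment> \<open>Away from z = 0 the majorant is 2 M exp(-z^2), with M uniform in n because the
      times stay in [t/2, t].\<close>
    show "(\<lambda>z. 2 * M * (indicator {0..} z * exp (- z\<^sup>2) + indicator {..0} z * exp (- z\<^sup>2)))
        integrable_on (UNIV - {0})"
      using half_gaussian_integrals
      by (intro integrable_on_mult_right integrable_add) blast+
    show "norm (g n z) \<le> 2 * M * (indicator {0..} z * exp (- z\<^sup>2) + indicator {..0} z * exp (- z\<^sup>2))"
      if "z \<in> UNIV - {0}" for n z
    proof -
      have 1: "indicator {0..} z * exp (- z\<^sup>2) + indicator {..0} z * exp (- z\<^sup>2) = exp (- z\<^sup>2)"
        using that by (auto simp: indicator_def)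
      have "\<bar>g n z\<bar> \<le> 2 * exp (- z\<^sup>2) * M"
        using M(1) M(2)[of "\<tau> n" "y n z"] \<tau>(2,3)[of n]
        by (auto simp: g_def abs_mult intro!: mult_left_mono)
      then show ?thesis unfolding 1 by (simp add: mult_ac)
    qed
    show "(\<lambda>n. g n z) \<longlonglongrightarrow> 2 * qx \<xi> t * p z" if z: "z \<in> UNIV - {0}" for z
    proof -
      consider "p z = exp (- z\<^sup>2)" "\<forall>\<^sub>F n in sequentially. y n z \<in> {l1 (\<tau> n)..l2 (\<tau> n)}"
        | "p z = 0" "\<forall>\<^sub>F n in sequentially. y n z \<notin> {l1 (\<tau> n)..l2 (\<tau> n)}"
        using pointwise[of z] z unfolding y_def by blast
      then show ?thesis
      proof cases
        case 1
        let ?S = "{(x, t). 0 < t \<and> t < T \<and> l1 t \<le> x \<and> x \<le> l2 t}"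
        have "(\<lambda>n. y n z) \<longlonglongrightarrow> \<xi> + 2 * sqrt (t - t) * z"
          unfolding y_def by (intro tendsto_intros \<tau>)
        then have lim: "(\<lambda>n. (y n z, \<tau> n)) \<longlonglongrightarrow> (\<xi>, t)"
          using \<tau>(1) by (intro tendsto_Pair) auto
        have "continuous_on ?S (\<lambda>(x, t). qx x t)"
          using regular by (auto simp: regular_up_to_boundary_def)
        then have "(\<lambda>n. (\<lambda>(x, t). qx x t) (y n z, \<tau> n)) \<longlonglongrightarrow> (\<lambda>(x, t). qx x t) (\<xi>, t)"
        proof (rule continuous_on_tendsto_compose[OF _ lim])
          show "\<forall>\<^sub>F n in sequentially. (y n z, \<tau> n) \<in> ?S"
            using 1(2)
            by eventually_elim (use \<tau>(3) \<tau>0 \<open>t < T\<close> in \<open>auto intro: less_trans\<close>)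
        qed (use assms in auto)
        then have "(\<lambda>n. 2 * exp (- z\<^sup>2) * qx (y n z) (\<tau> n)) \<longlonglongrightarrow> 2 * exp (- z\<^sup>2) * qx \<xi> t"
          by (intro tendsto_intros) simp
        then have "(\<lambda>n. g n z) \<longlonglongrightarrow> 2 * exp (- z\<^sup>2) * qx \<xi> t"
          by (rule Lim_transform_eventually)
             (use 1(2) in eventually_elim, simp add: g_def)
        then show ?thesis using 1 by (simp add: mult_ac)
      next
        case 2
        have "(\<lambda>n. g n z) \<longlonglongrightarrow> 0"
          by (rule tendsto_eventually) (use 2(2) in eventually_elim, auto simp: g_def)
        then show ?thesis using 2 by simp
      qed
    qed
  qed
  moreover have "integral (UNIV - {0}) (g n) = \<Phi> \<xi> t (\<tau> n)" for n
    using g by (rule integral_unique)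
  moreover have "integral (UNIV - {0}) p = sqrt pi / 2"
    using p by (rule integral_unique)
  ultimately show ?thesis by (simp add: mult_ac)
qed

text \<open>The offset 2 keeps every term in [t/2, t), starting with n = 0.\<close>

definition \<tau> :: "real \<Rightarrow> nat \<Rightarrow> real" where
  "\<tau> t n = t - t / (real n + 2)"

lemma \<tau>:
  assumes "0 < t"
  shows "\<tau> t \<longlonglongrightarrow> t" "t / 2 \<le> \<tau> t n" "\<tau> t n < t" "0 < \<tau> t n"
proof -
  have "filterlim (\<lambda>n. real n + 2) at_top sequentially"
    by (rule filterlim_at_top_mono[OF filterlim_real_sequentially]) (auto intro: always_eventually)
  then have "(\<lambda>n. t - t / (real n + 2)) \<longlonglongrightarrow> t - 0"
    by (intro tendsto_diff tendsto_const tendsto_divide_0 filterlim_at_top_imp_at_infinity) auto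
  then show "\<tau> t \<longlonglongrightarrow> t" by (simp add: \<tau>_def[abs_def])
  show *: "t / 2 \<le> \<tau> t n" "\<tau> t n < t"
    using assms by (simp_all add: \<tau>_def field_simps)
  then show "0 < \<tau> t n" using assms by linarith
qed

text \<open>By the Lipschitz bound the curve moves by O(t - s), so after division by sqrt(t - s) the
  shift is still O(sqrt(t - s)).\<close>

lemma boundary_shift_tendsto_0:
  assumes "C1_on l l' {0..T}" "0 < t" "t < T"
  shows "(\<lambda>n. (l (\<tau> t n) - l t) / (2 * sqrt (t - \<tau> t n))) \<longlonglongrightarrow> 0"
proof -
  obtain C where C: "C \<ge> 0" "\<And>s t. s \<in> {0..T} \<Longrightarrow> t \<in> {0..T} \<Longrightarrow> \<bar>l t - l s\<bar> \<le> C * \<bar>t - s\<bar>"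
    using C1_on_lipschitz[OF assms(1)] by blast
  have "(\<lambda>n. C / 2 * sqrt (t - \<tau> t n)) \<longlonglongrightarrow> C / 2 * sqrt (t - t)"
    by (intro tendsto_intros \<tau>(1) assms)
  then have lim: "(\<lambda>n. C / 2 * sqrt (t - \<tau> t n)) \<longlonglongrightarrow> 0" by simp
  show ?thesis
  proof (rule Lim_null_comparison[OF always_eventually lim], rule allI)
    fix n
    let ?r = "sqrt (t - \<tau> t n)"
    have r: "?r > 0" "t - \<tau> t n = ?r * ?r" using \<tau>(2-4)[OF assms(2), of n] by simp_all
    have "\<bar>l (\<tau> t n) - l t\<bar> \<le> C * (?r * ?r)"
      using C(2)[of t "\<tau> t n"] \<tau>(2-4)[OF assms(2), of n] assms r(2) by auto
    then have "\<bar>l (\<tau> t n) - l t\<bar> / (2 * ?r) \<le> C * (?r * ?r) / (2 * ?r)"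
      using r(1) by (intro divide_right_mono) auto
    moreover have "C * (x * x) / (2 * x) = C / 2 * x" if "x > 0" for x :: real
      using that by simp
    ultimately have "\<bar>l (\<tau> t n) - l t\<bar> / (2 * ?r) \<le> C / 2 * ?r"
      using r(1) by metis
    then show "norm ((l (\<tau> t n) - l t) / (2 * ?r)) \<le> C / 2 * ?r"
      using r(1) by (simp add: abs_divide)
  qed
qed

lemma \<tau>_tendsto:
  assumes "0 < t" "t < T"
  shows "(\<lambda>n. l1 (\<tau> t n)) \<longlonglongrightarrow> l1 t" "(\<lambda>n. l2 (\<tau> t n)) \<longlonglongrightarrow> l2 t"
    "(\<lambda>n. \<xi> + 2 * sqrt (t - \<tau> t n) * z) \<longlonglongrightarrow> \<xi>"
proof -
  have "isCont l1 t" "isCont l2 t" using DERIV_l[OF assms] DERIV_isCont by blast+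
  then show "(\<lambda>n. l1 (\<tau> t n)) \<longlonglongrightarrow> l1 t" "(\<lambda>n. l2 (\<tau> t n)) \<longlonglongrightarrow> l2 t"
    using \<tau>(1)[OF assms(1)] isCont_tendsto_compose by blast+
  have "(\<lambda>n. \<xi> + 2 * sqrt (t - \<tau> t n) * z) \<longlonglongrightarrow> \<xi> + 2 * sqrt (t - t) * z"
    by (intro tendsto_intros \<tau>(1) assms)
  then show "(\<lambda>n. \<xi> + 2 * sqrt (t - \<tau> t n) * z) \<longlonglongrightarrow> \<xi>" by simp
qed

text \<open>For z > 0 the rescaled point eventually lies right of the left curve, since the shift
  tends to 0, and left of the other curve, since l1 t < l2 t. For z < 0 it eventually lies outside.
  The limit weight is thus the right half Gaussian.\<close>

lemma \<Phi>_limit_left: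
  assumes "0 < t" "t < T"
  shows "(\<lambda>n. \<Phi> (l1 t) t (\<tau> t n)) \<longlonglongrightarrow> sqrt pi * f1 t"
proof -
  have lt: "l1 t < l2 t" using l_less assms by simp
  have r: "sqrt (t - \<tau> t n) > 0" for n using \<tau>(3)[OF assms(1)] by simp
  have iff: "l1 (\<tau> t n) \<le> l1 t + 2 * sqrt (t - \<tau> t n) * z \<longleftrightarrow>
      (l1 (\<tau> t n) - l1 t) / (2 * sqrt (t - \<tau> t n)) \<le> z" for z n
    using r[of n] by (simp add: field_simps)
  note shift = boundary_shift_tendsto_0[OF l1 assms]
  have "(\<lambda>n. \<Phi> (l1 t) t (\<tau> t n)) \<longlonglongrightarrow> sqrt pi * qx (l1 t) t"
  proof (rule \<Phi>_limit[OF assms _ _ _ _ _ half_gaussian_integrals(1)])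
    fix z :: real assume "z \<noteq> 0"
    then consider "z > 0" | "z < 0" by linarith
    then show "indicator {0..} z * exp (- z\<^sup>2) = exp (- z\<^sup>2) \<and>
         (\<forall>\<^sub>F n in sequentially. l1 t + 2 * sqrt (t - \<tau> t n) * z \<in> {l1 (\<tau> t n)..l2 (\<tau> t n)}) \<or>
       indicator {0..} z * exp (- z\<^sup>2) = 0 \<and>
         (\<forall>\<^sub>F n in sequentially. l1 t + 2 * sqrt (t - \<tau> t n) * z \<notin> {l1 (\<tau> t n)..l2 (\<tau> t n)})"
    proof cases
      case 1
      have "\<forall>\<^sub>F n in sequentially. 0 < l2 (\<tau> t n) - (l1 t + 2 * sqrt (t - \<tau> t n) * z)"
        by (rule order_tendstoD(1)[OF tendsto_diff[OF \<tau>_tendsto(2,3)[OF assms]]]) (use lt in simp)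
      moreover have "\<forall>\<^sub>F n in sequentially. (l1 (\<tau> t n) - l1 t) / (2 * sqrt (t - \<tau> t n)) < z"
        by (rule order_tendstoD(2)[OF shift 1])
      ultimately have "\<forall>\<^sub>F n in sequentially. l1 t + 2 * sqrt (t - \<tau> t n) * z \<in> {l1 (\<tau> t n)..l2 (\<tau> t n)}"
        by eventually_elim (simp add: iff)
      then show ?thesis using 1 by simp
    next
      case 2
      have "\<forall>\<^sub>F n in sequentially. z < (l1 (\<tau> t n) - l1 t) / (2 * sqrt (t - \<tau> t n))"
        by (rule order_tendstoD(1)[OF shift 2])
      then have "\<forall>\<^sub>F n in sequentially. l1 t + 2 * sqrt (t - \<tau> t n) * z \<notin> {l1 (\<tau> t n)..l2 (\<tau> t n)}"
        by eventually_elim (simp add: iff)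
      then show ?thesis using 2 by simp
    qed
  qed (use lt \<tau>[OF assms(1)] in auto)
  then show ?thesis by (simp add: qx_left assms)
qed

text \<open>The mirror image: the interval now exhausts the negative half line.\<close>

lemma \<Phi>_limit_right:
  assumes "0 < t" "t < T"
  shows "(\<lambda>n. \<Phi> (l2 t) t (\<tau> t n)) \<longlonglongrightarrow> sqrt pi * g1 t"
proof -
  have lt: "l1 t < l2 t" using l_less assms by simp
  have r: "sqrt (t - \<tau> t n) > 0" for n using \<tau>(3)[OF assms(1)] by simp
  have iff: "l2 t + 2 * sqrt (t - \<tau> t n) * z \<le> l2 (\<tau> t n) \<longleftrightarrow>
      z \<le> (l2 (\<tau> t n) - l2 t) / (2 * sqrt (t - \<tau> t n))" for z n
    using r[of n] by (simp add: field_simps)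
  note shift = boundary_shift_tendsto_0[OF l2 assms]
  have "(\<lambda>n. \<Phi> (l2 t) t (\<tau> t n)) \<longlonglongrightarrow> sqrt pi * qx (l2 t) t"
  proof (rule \<Phi>_limit[OF assms _ _ _ _ _ half_gaussian_integrals(2)])
    fix z :: real assume "z \<noteq> 0"
    then consider "z < 0" | "z > 0" by linarith
    then show "indicator {..0} z * exp (- z\<^sup>2) = exp (- z\<^sup>2) \<and>
         (\<forall>\<^sub>F n in sequentially. l2 t + 2 * sqrt (t - \<tau> t n) * z \<in> {l1 (\<tau> t n)..l2 (\<tau> t n)}) \<or>
       indicator {..0} z * exp (- z\<^sup>2) = 0 \<and>
         (\<forall>\<^sub>F n in sequentially. l2 t + 2 * sqrt (t - \<tau> t n) * z \<notin> {l1 (\<tau> t n)..l2 (\<tau> t n)})"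
    proof cases
      case 1
      have "\<forall>\<^sub>F n in sequentially. 0 < (l2 t + 2 * sqrt (t - \<tau> t n) * z) - l1 (\<tau> t n)"
        by (rule order_tendstoD(1)[OF tendsto_diff[OF \<tau>_tendsto(3,1)[OF assms]]]) (use lt in simp)
      moreover have "\<forall>\<^sub>F n in sequentially. z < (l2 (\<tau> t n) - l2 t) / (2 * sqrt (t - \<tau> t n))"
        by (rule order_tendstoD(1)[OF shift 1])
      ultimately have "\<forall>\<^sub>F n in sequentially. l2 t + 2 * sqrt (t - \<tau> t n) * z \<in> {l1 (\<tau> t n)..l2 (\<tau> t n)}"
        by eventually_elim (simp add: iff)
      then show ?thesis using 1 by simp
    next
      case 2
      have "\<forall>\<^sub>F n in sequentially. (l2 (\<tau> t n) - l2 t) / (2 * sqrt (t - \<tau> t n)) < z"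
        by (rule order_tendstoD(2)[OF shift 2])
      then have "\<forall>\<^sub>F n in sequentially. l2 t + 2 * sqrt (t - \<tau> t n) * z \<notin> {l1 (\<tau> t n)..l2 (\<tau> t n)}"
        by eventually_elim (simp add: iff)
      then show ?thesis using 2 by simp
    qed
  qed (use lt \<tau>[OF assms(1)] in auto)
  then show ?thesis by (simp add: qx_right assms)
qed

lemma kernels_absolutely_integrable:
  assumes "0 < t" "t < T" "continuous_on {0..T} \<phi>"
  shows "(\<lambda>s. kern (\<xi> - l1 s) (t - s) * \<phi> s) absolutely_integrable_on {0..t}"
    and "(\<lambda>s. kern (\<xi> - l2 s) (t - s) * \<phi> s) absolutely_integrable_on {0..t}"
    and "(\<lambda>s. kern1 (\<xi> - l1 s) (t - s) * \<phi> s) absolutely_integrable_on {0..t}"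
    and "(\<lambda>s. kern1 (\<xi> - l2 s) (t - s) * \<phi> s) absolutely_integrable_on {0..t}"
proof -
  have sub: "{0..t} \<subseteq> {0..T}" using assms by auto
  then have c: "continuous_on {0..t} l1" "continuous_on {0..t} l2" "continuous_on {0..t} \<phi>"
    using continuous_on_data(1,2)[of "{0..t}" "\<lambda>x. x"] continuous_on_subset[OF assms(3) sub] by auto
  have t: "0 \<le> t" using assms by simp
  show "(\<lambda>s. kern (\<xi> - l1 s) (t - s) * \<phi> s) absolutely_integrable_on {0..t}"
    "(\<lambda>s. kern (\<xi> - l2 s) (t - s) * \<phi> s) absolutely_integrable_on {0..t}"
    by (intro kern_absolutely_integrable c t)+
  obtain C1 where C1: "C1 \<ge> 0" "\<And>s t. s \<in> {0..T} \<Longrightarrow> t \<in> {0..T} \<Longrightarrow> \<bar>l1 t - l1 s\<bar> \<le> C1 * \<bar>t - s\<bar>"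
    using C1_on_lipschitz[OF l1] by blast
  have "\<bar>l1 t - l1 s\<bar> \<le> C1 * (t - s)" if "s \<in> {0..t}" for s
    using C1(2)[of s t] that assms by auto
  then show "(\<lambda>s. kern1 (\<xi> - l1 s) (t - s) * \<phi> s) absolutely_integrable_on {0..t}"
    by (rule kern1_absolutely_integrable[OF t c(1,3) C1(1)])
  obtain C2 where C2: "C2 \<ge> 0" "\<And>s t. s \<in> {0..T} \<Longrightarrow> t \<in> {0..T} \<Longrightarrow> \<bar>l2 t - l2 s\<bar> \<le> C2 * \<bar>t - s\<bar>"
    using C1_on_lipschitz[OF l2] by blast
  have "\<bar>l2 t - l2 s\<bar> \<le> C2 * (t - s)" if "s \<in> {0..t}" for s
    using C2(2)[of s t] that assms by auto
  then show "(\<lambda>s. kern1 (\<xi> - l2 s) (t - s) * \<phi> s) absolutely_integrable_on {0..t}"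
    by (rule kern1_absolutely_integrable[OF t c(2,3) C2(1)])
qed

section \<open>The integral equations\<close>

text \<open>Let s tend to t along \<open>\<tau>\<close> in the balance law from time 0. The flux is
  integrable up to t, so its indefinite integral is continuous there. Keeping \<open>lj\<close> and
  u abstract serves both boundary curves.\<close>

lemma integral_equation:
  assumes t: "0 < t" "t < T"
    and lim: "(\<lambda>n. \<Phi> (lj t) t (\<tau> t n)) \<longlonglongrightarrow> sqrt pi * u"
  shows "pi * u = data_N (l2 0) lj l1 l2 q0' f0' g0' t
      + integral {0..t} (\<lambda>s. kernel_K lj l1 t s * f1 s)
      - integral {0..t} (\<lambda>s. kernel_K lj l2 t s * g1 s)"
proof -
  let ?\<xi> = "lj t"
  have data: "continuous_on {0..T} f0'" "continuous_on {0..T} g0'"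
    using f0 g0 by (auto simp: C1_on_def)
  note int = kernels_absolutely_integrable[OF t, THEN set_lebesgue_integral_eq_integral(1)]
  note i = int(4)[OF cont_g1, of ?\<xi>] int(3)[OF cont_f1, of ?\<xi>] int(2)[OF data(2), of ?\<xi>]
    int(1)[OF data(1), of ?\<xi>]
  have flux: "flux ?\<xi> t integrable_on {0..t}"
    unfolding flux_def[abs_def] by (intro integrable_add integrable_diff i)
  have "continuous_on {0..t} (\<lambda>d. integral {0..d} (flux ?\<xi> t))"
    using flux by (rule indefinite_integral_continuous_1)
  then have "(\<lambda>n. integral {0..\<tau> t n} (flux ?\<xi> t)) \<longlonglongrightarrow> integral {0..t} (flux ?\<xi> t)"
    by (rule continuous_on_tendsto_compose[OF _ \<tau>(1)[OF t(1)]])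
       (use t \<tau>(3,4)[OF t(1)] in \<open>auto intro!: always_eventually less_imp_le\<close>)
  moreover have "integral {0..\<tau> t n} (flux ?\<xi> t) = \<Phi> ?\<xi> t 0 - \<Phi> ?\<xi> t (\<tau> t n)" for n
    using \<Phi>_diff_initial[of "\<tau> t n" t ?\<xi>] \<tau>(3,4)[OF t(1), of n] t by simp
  moreover have "(\<lambda>n. \<Phi> ?\<xi> t 0 - \<Phi> ?\<xi> t (\<tau> t n)) \<longlonglongrightarrow> \<Phi> ?\<xi> t 0 - sqrt pi * u"
    by (intro tendsto_intros lim)
  ultimately have eq: "integral {0..t} (flux ?\<xi> t) = \<Phi> ?\<xi> t 0 - sqrt pi * u"
    using LIMSEQ_unique by simp
  let ?h = "integral {0..t} (\<lambda>s. heat_kernel lj l1 t s * f0' s - heat_kernel lj l2 t s * g0' s)"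
  let ?k1 = "integral {0..t} (\<lambda>s. kern1 (?\<xi> - l1 s) (t - s) * f1 s)"
  let ?k2 = "integral {0..t} (\<lambda>s. kern1 (?\<xi> - l2 s) (t - s) * g1 s)"
  have flux_int: "integral {0..t} (flux ?\<xi> t) = ?k2 - ?k1 + ?h"
  proof (rule integral_unique[OF has_integral_eq])
    show "((\<lambda>s. kern1 (?\<xi> - l2 s) (t - s) * g1 s - kern1 (?\<xi> - l1 s) (t - s) * f1 s
        + (heat_kernel lj l1 t s * f0' s - heat_kernel lj l2 t s * g0' s)) has_integral ?k2 - ?k1 + ?h) {0..t}"
      unfolding heat_kernel_eq_kern
      by (intro has_integral_add has_integral_diff integrable_integral integrable_diff i)
  qed (simp add: flux_def heat_kernel_eq_kern)
  have K: "integral {0..t} (\<lambda>s. kernel_K lj l1 t s * f1 s) = sqrt pi * ?k1"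
    "integral {0..t} (\<lambda>s. kernel_K lj l2 t s * g1 s) = sqrt pi * ?k2"
    by (simp_all add: kernel_K_eq_kern1 mult.assoc)
  have "\<Phi> ?\<xi> t 0 = integral {0..l2 0} (\<lambda>x. 1 / sqrt t * (exp (- ((x - ?\<xi>)\<^sup>2 / (4 * t))) * q0' x))"
    using t by (simp add: \<Phi>_initial kern_def power2_commute[of ?\<xi>])
  also have "\<dots> = 1 / sqrt t * integral {0..l2 0} (\<lambda>x. exp (- ((x - ?\<xi>)\<^sup>2 / (4 * t))) * q0' x)"
    by (rule integral_mult_right)
  finally have init: "data_N (l2 0) lj l1 l2 q0' f0' g0' t = sqrt pi * (\<Phi> ?\<xi> t 0 - ?h)"
    by (simp add: data_N_def)
  have "sqrt pi * u = \<Phi> ?\<xi> t 0 - (?k2 - ?k1 + ?h)" using eq flux_int by simp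
  \<comment> \<open>The additional factor sqrt(pi) turns \<open>kern1\<close> into
    \<open>kernel_K\<close> and the left side into pi u.\<close>
  then have "sqrt pi * (sqrt pi * u) = sqrt pi * (\<Phi> ?\<xi> t 0 - (?k2 - ?k1 + ?h))" by simp
  moreover have "sqrt pi * (sqrt pi * u) = pi * u" by (simp flip: mult.assoc)
  ultimately show ?thesis unfolding init K by (simp add: algebra_simps)
qed

lemma terms_absolutely_integrable:
  assumes t: "0 < t" "t < T"
  shows "(\<lambda>x. exp (- ((x - lj t)\<^sup>2 / (4 * t))) * q0' x) absolutely_integrable_on {0..l2 0}"
    and "(\<lambda>s. heat_kernel lj l1 t s * f0' s - heat_kernel lj l2 t s * g0' s)
         absolutely_integrable_on {0..t}"
    and "(\<lambda>s. kernel_K lj l1 t s * f1 s) absolutely_integrable_on {0..t}"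
    and "(\<lambda>s. kernel_K lj l2 t s * g1 s) absolutely_integrable_on {0..t}"
proof -
  have data: "continuous_on {0..T} f0'" "continuous_on {0..T} g0'" "continuous_on {0..l2 0} q0'"
    using f0 g0 q0 by (auto simp: C1_on_def)
  show "(\<lambda>x. exp (- ((x - lj t)\<^sup>2 / (4 * t))) * q0' x) absolutely_integrable_on {0..l2 0}"
    using t by (intro absolutely_integrable_continuous_real continuous_intros data) auto
  show "(\<lambda>s. heat_kernel lj l1 t s * f0' s - heat_kernel lj l2 t s * g0' s)
         absolutely_integrable_on {0..t}"
    unfolding heat_kernel_eq_kern
    by (intro set_integral_diff(1) kernels_absolutely_integrable t data)
  show "(\<lambda>s. kernel_K lj l1 t s * f1 s) absolutely_integrable_on {0..t}"
    "(\<lambda>s. kernel_K lj l2 t s * g1 s) absolutely_integrable_on {0..t}"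
    unfolding kernel_K_eq_kern1 mult.assoc
    by (intro set_integrable_mult_right kernels_absolutely_integrable t cont_f1 cont_g1)+
qed

end

theorem proposition1:
  fixes T L :: real
    and l1 l2 l1' l2' q0 q0' f0 f0' g0 g0' f1 g1 :: "real \<Rightarrow> real"
    and q qx :: "real \<Rightarrow> real \<Rightarrow> real"
  assumes "T > 0" and "L \<ge> 0"
    and "C1_on l1 l1' {0..T}" and "C1_on l2 l2' {0..T}"
    and "l1 0 = 0" and "l2 0 = L"
    and "\<And>s. 0 < s \<Longrightarrow> s \<le> T \<Longrightarrow> l1 s < l2 s"
    and "C1_on q0 q0' {0..L}" and "C1_on f0 f0' {0..T}" and "C1_on g0 g0' {0..T}"
    and "heat_solution_on (moving_domain l1 l2 T) q"
    and "regular_up_to_boundary l1 l2 T q qx"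
    and "\<And>x. 0 < x \<Longrightarrow> x < L \<Longrightarrow> q x 0 = q0 x"
    and "\<And>t. 0 < t \<Longrightarrow> t < T \<Longrightarrow> q (l1 t) t = f0 t"
    and "\<And>t. 0 < t \<Longrightarrow> t < T \<Longrightarrow> q (l2 t) t = g0 t"
    and "continuous_on {0..T} f1" and "continuous_on {0..T} g1"
    and "\<And>t. 0 < t \<Longrightarrow> t < T \<Longrightarrow> f1 t = qx (l1 t) t"
    and "\<And>t. 0 < t \<Longrightarrow> t < T \<Longrightarrow> g1 t = qx (l2 t) t"
  shows "\<forall>t. 0 < t \<and> t < T \<longrightarrow>
    (\<forall>lj\<in>{l1, l2}.
       (\<lambda>x. exp (- ((x - lj t)\<^sup>2 / (4 * t))) * q0' x) absolutely_integrable_on {0..L} \<and>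
       (\<lambda>s. heat_kernel lj l1 t s * f0' s - heat_kernel lj l2 t s * g0' s)
         absolutely_integrable_on {0..t} \<and>
       (\<lambda>s. kernel_K lj l1 t s * f1 s) absolutely_integrable_on {0..t} \<and>
       (\<lambda>s. kernel_K lj l2 t s * g1 s) absolutely_integrable_on {0..t}) \<and>
    pi * f1 t = data_N L l1 l1 l2 q0' f0' g0' t
      + integral {0..t} (\<lambda>s. kernel_K l1 l1 t s * f1 s)
      - integral {0..t} (\<lambda>s. kernel_K l1 l2 t s * g1 s) \<and>
    pi * g1 t = data_N L l2 l1 l2 q0' f0' g0' t
      - integral {0..t} (\<lambda>s. kernel_K l2 l2 t s * g1 s)
      + integral {0..t} (\<lambda>s. kernel_K l2 l1 t s * f1 s)"
proof -
  let ?D = "moving_domain l1 l2 T"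
  from \<open>heat_solution_on ?D q\<close> obtain qt p qxx where
    sol: "\<And>x t. (x, t) \<in> ?D \<Longrightarrow> ((\<lambda>s. q x s) has_real_derivative qt x t) (at t)"
      "\<And>x t. (x, t) \<in> ?D \<Longrightarrow> ((\<lambda>y. q y t) has_real_derivative p x t) (at x)"
      "\<And>x t. (x, t) \<in> ?D \<Longrightarrow> ((\<lambda>y. p y t) has_real_derivative qxx x t) (at x)"
      "\<And>x t. (x, t) \<in> ?D \<Longrightarrow> qt x t - qxx x t = 0"
    and cont: "continuous_on ?D (\<lambda>(x, t). qt x t)"
    unfolding heat_solution_on_def by fast
  \<comment> \<open>The x-derivative provided by \<open>heat_solution_on\<close> and the one
    provided by the boundary regularity agree in the interior by uniqueness of derivatives, so the
    heat equation can be stated with \<open>qx\<close>.\<close>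
  have p: "p x t = qx x t" if "(x, t) \<in> ?D" for x t
  proof -
    have x: "l1 t < x" "x < l2 t" "0 < t" "t < T"
      using that by (auto simp: moving_domain_def)
    then have "((\<lambda>y. q y t) has_real_derivative qx x t) (at x within {l1 t..l2 t})"
      using assms(12) by (auto simp: regular_up_to_boundary_def)
    moreover have "at x within {l1 t..l2 t} = at x"
      using x by (intro at_within_interior) (simp add: interior_atLeastAtMost_real)
    ultimately show ?thesis using DERIV_unique[OF sol(2)[OF that]] by simp
  qed
  have xx: "((\<lambda>y. qx y t) has_real_derivative qt x t) (at x)" if "(x, t) \<in> ?D" for x t
  proof -
    have "((\<lambda>y. p y t) has_real_derivative qt x t) (at x)"
      using sol(3,4)[OF that] by simp
    then show ?thesis
      by (rule has_field_derivative_transform_within_open[of _ _ _ "{l1 t<..<l2 t}"])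
         (use that p in \<open>auto simp: moving_domain_def\<close>)
  qed
  interpret moving_heat_problem T l1 l2 l1' l2' q0 q0' f0 f0' g0 g0' f1 g1 q qx qt
    by unfold_locales (use assms sol(1) xx cont in auto)
  show ?thesis
  proof (intro allI impI, elim conjE)
    fix t assume t: "0 < t" "t < T"
    note eqs = integral_equation[where lj = l1, OF t \<Phi>_limit_left[OF t]]
      integral_equation[where lj = l2, OF t \<Phi>_limit_right[OF t]]
    note abs_int = terms_absolutely_integrable[OF t, where lj = l1]
      terms_absolutely_integrable[OF t, where lj = l2]
    show "(\<forall>lj\<in>{l1, l2}.
       (\<lambda>x. exp (- ((x - lj t)\<^sup>2 / (4 * t))) * q0' x) absolutely_integrable_on {0..L} \<and>
       (\<lambda>s. heat_kernel lj l1 t s * f0' s - heat_kernel lj l2 t s * g0' s)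
         absolutely_integrable_on {0..t} \<and>
       (\<lambda>s. kernel_K lj l1 t s * f1 s) absolutely_integrable_on {0..t} \<and>
       (\<lambda>s. kernel_K lj l2 t s * g1 s) absolutely_integrable_on {0..t}) \<and>
    pi * f1 t = data_N L l1 l1 l2 q0' f0' g0' t
      + integral {0..t} (\<lambda>s. kernel_K l1 l1 t s * f1 s)
      - integral {0..t} (\<lambda>s. kernel_K l1 l2 t s * g1 s) \<and>
    pi * g1 t = data_N L l2 l1 l2 q0' f0' g0' t
      - integral {0..t} (\<lambda>s. kernel_K l2 l2 t s * g1 s)
      + integral {0..t} (\<lambda>s. kernel_K l2 l1 t s * f1 s)"
      using eqs abs_int \<open>l2 0 = L\<close> by simp
  qed
qed

end
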